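(* Let $a,b$ be non-negative integers, and let $\delta_1,\delta_2,\tau\in\{\pm 1\}$. For all integers $m,n$ satisfying $0\leq m\leq a$ and $0\leq n\leq b$, the following identity holds in $\mathcal{A}$: \begin{align*} &\sum_{\substack{0\leq i\leq a\\ 0\leq j\leq b}}\binom{i}{m}\binom{j}{n}\sum_{\substack{|\boldsymbol{k}|_{a-i+1}=a+b-i-j+1\\|\boldsymbol{l}|_{i+1}=i+j+1}}M_{\mathcal{A}}(\boldsymbol{k},\boldsymbol{l};\delta_1,\delta_1\tau,\ldots,\delta_1\tau^{a-i},\delta_1\delta_2\tau^{a-i},\ldots,\delta_1\delta_2\tau^{a-1},\delta_1\delta_2\tau^{a})\\ &+\sum_{\substack{0\leq i\leq a\\ 0\leq j\leq b}}\binom{i}{a-m}\binom{j}{b-n}\sum_{\substack{|\boldsymbol{k}|_{a-i+1}=a+b-i-j+1\\|\boldsymbol{l}|_{i+1}=i+j+1}}M_{\mathcal{A}}(\boldsymbol{k},\boldsymbol{l};\delta_2,\delta_2\tau,\ldots,\delta_2\tau^{a-i},\delta_1\delta_2\tau^{a-i},\ldots,\delta_1\delta_2\tau^{a-1},\delta_1\delta_2\tau^{a})\\ &=\sum_{\substack{|\boldsymbol{k}|_{a-m+1}=a+b-m-n+1\\|\boldsymbol{l}|_{m+1}=m+n+1}}(-1)^{m+n+1}M_{\mathcal{A}}(\boldsymbol{k},\boldsymbol{l};\delta_1,\delta_1\tau,\ldots,\delta_1\tau^{a-m},-\delta_2\tau^{m},-\delta_2\tau^{m-1},\ldots,-\delta_2\tau,-\delta_2).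 \end{align*} In the first two sums the sign sequence consists of a block of length $a-i+1$ (namely $\delta_1\tau^{s}$, respectively $\delta_2\tau^{s}$, for $s=0,\ldots,a-i$) followed by a block of length $i+1$ (namely $\delta_1\delta_2\tau^{s}$ for $s=a-i,\ldots,a$); on the right-hand side it consists of $\delta_1\tau^s$ for $s=0,\ldots,a-m$ followed by $-\delta_2\tau^{s}$ for $s=m,m-1,\ldots,0$.
   Context: Let $\mathcal{P}$ be the set of primes and $\mathcal{A}:=\prod_{p\in\mathcal{P}}(\mathbb{Z}/p\mathbb{Z})\big/\bigoplus_{p\in\mathcal{P}}(\mathbb{Z}/p\mathbb{Z})$, a $\mathbb{Q}$-algebra in which an element is determined by its components at all but finitely many primes. An index is a finite sequence $\boldsymbol{k}=(k_1,\ldots,k_r)$ of positive integers. For an index $\boldsymbol{k}=(k_1,\ldots,k_r)$, signs $\boldsymbol{\varepsilon}=(\varepsilon_1,\ldots,\varepsilon_r)\in\{\pm1\}^r$ and a positive integer $N$, put $$M_N(\boldsymbol{k};\boldsymbol{\varepsilon}):=\sum_{0<m_1<\cdots<m_r<N}\frac{(1+\varepsilon_1(-1)^{m_1})\cdots(1+\varepsilon_r(-1)^{m_r})}{m_1^{k_1}\cdots m_r^{k_r}},$$ and define the finite multiple mixed value $M_{\mathcal{A}}(\boldsymbol{k};\boldsymbol{\varepsilon}):=\bigl(M_p(\boldsymbol{k};\boldsymbol{\varepsilon})\bmod p\bigr)_{p\in\mathcal{P}}\in\mathcal{A}$. Here $(\boldsymbol{k},\boldsymbol{l})$ denotes concatenation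 of indices. The notation $\sum_{|\boldsymbol{k}|_{r}=N}$ means that the sum runs over all indices $\boldsymbol{k}=(k_1,\ldots,k_r)$ of positive integers with $k_1+\cdots+k_r=N$; when two such conditions are listed, the sum is over all pairs $(\boldsymbol{k},\boldsymbol{l})$ satisfying both. Binomial coefficients $\binom{i}{m}$ are $0$ if $m>i$. *)

theory Defs
  imports "HOL-Algebra.QuotRing" "HOL-Number_Theory.Residues" "HOL-Number_Theory.Modular_Inverse"
begin

definition product_ring :: "'i set \<Rightarrow> ('i \<Rightarrow> ('a, 'b) ring_scheme) \<Rightarrow> ('i \<Rightarrow> 'a) ring" where
  "product_ring I R =
    \<lparr>carrier = (\<Pi>\<^sub>E i\<in>I. carrier (R i)),
     monoid.mult = (\<lambda>x y. \<lambda>i\<in>I. x i \<otimes>\<^bsub>R i\<^esub> y i),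
     one = (\<lambda>i\<in>I. \<one>\<^bsub>R i\<^esub>),
     ring.zero = (\<lambda>i\<in>I. \<zero>\<^bsub>R i\<^esub>),
     add = (\<lambda>x y. \<lambda>i\<in>I. x i \<oplus>\<^bsub>R i\<^esub> y i)\<rparr>"

definition direct_sum :: "'i set \<Rightarrow> ('i \<Rightarrow> ('a, 'b) ring_scheme) \<Rightarrow> ('i \<Rightarrow> 'a) set" where
  "direct_sum I R = {x \<in> carrier (product_ring I R). finite {i \<in> I. x i \<noteq> \<zero>\<^bsub>R i\<^esub>}}"

abbreviation primes :: "nat set" where
  "primes \<equiv> {p. prime p}"

abbreviation Zmod :: "nat \<Rightarrow> int ring" where
  "Zmod p \<equiv> residue_ring (int p)"

definition prod_Zp :: "(nat \<Rightarrow> int) ring" where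
  "prod_Zp = product_ring primes Zmod"

definition sum_Zp :: "(nat \<Rightarrow> int) set" where
  "sum_Zp = direct_sum primes Zmod"

definition ringA :: "(nat \<Rightarrow> int) set ring" ("\<A>") where
  "\<A> = prod_Zp Quot sum_Zp"

definition class_A :: "(nat \<Rightarrow> int) \<Rightarrow> (nat \<Rightarrow> int) set" where
  "class_A x = sum_Zp +>\<^bsub>prod_Zp\<^esub> (\<lambda>p\<in>primes. x p mod int p)"

lemma cring_product_ring:
  assumes "\<And>i. i \<in> I \<Longrightarrow> cring (R i)"
  shows "cring (product_ring I R)"
proof -
  let ?P = "product_ring I R"
  have mem: "x i \<in> carrier (R i)" if "x \<in> carrier ?P" "i \<in> I" for x i
    using that by (auto simp: product_ring_def)
  have carI: "(\<lambda>i\<in>I. f i) \<in> carrier ?P" if "\<And>i. i \<in> I \<Longrightarrow> f i \<in> carrier (R i)" for f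
    using that by (auto simp: product_ring_def)
  have restr: "(\<lambda>i\<in>I. x i) = x" if "x \<in> carrier ?P" for x
    using that by (auto simp: product_ring_def)
  have ops: "x \<otimes>\<^bsub>?P\<^esub> y = (\<lambda>i\<in>I. x i \<otimes>\<^bsub>R i\<^esub> y i)" "x \<oplus>\<^bsub>?P\<^esub> y = (\<lambda>i\<in>I. x i \<oplus>\<^bsub>R i\<^esub> y i)"
    "\<one>\<^bsub>?P\<^esub> = (\<lambda>i\<in>I. \<one>\<^bsub>R i\<^esub>)" "\<zero>\<^bsub>?P\<^esub> = (\<lambda>i\<in>I. \<zero>\<^bsub>R i\<^esub>)" for x y
    by (simp_all add: product_ring_def)
  note cr = cring.cring_simprules[OF assms]
  have addcl: "x \<oplus>\<^bsub>?P\<^esub> y \<in> carrier ?P" if "x \<in> carrier ?P" "y \<in> carrier ?P" for x y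
    unfolding ops by (intro carI cr(1) mem that)
  have mulcl: "x \<otimes>\<^bsub>?P\<^esub> y \<in> carrier ?P" if "x \<in> carrier ?P" "y \<in> carrier ?P" for x y
    unfolding ops by (intro carI cr(5) mem that)
  show ?thesis
  proof (rule cringI)
    show "abelian_group ?P"
    proof (rule abelian_groupI)
      show "\<zero>\<^bsub>?P\<^esub> \<in> carrier ?P"
        unfolding ops by (intro carI cr(2))
      fix x assume x: "x \<in> carrier ?P"
      show "\<zero>\<^bsub>?P\<^esub> \<oplus>\<^bsub>?P\<^esub> x = x"
      proof -
        have "\<zero>\<^bsub>?P\<^esub> \<oplus>\<^bsub>?P\<^esub> x = (\<lambda>i\<in>I. x i)"
          unfolding ops by (intro restrict_ext) (simp add: cr(8) mem x)
        then show ?thesis using restr[OF x] by simp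
      qed
      have "(\<lambda>i\<in>I. \<ominus>\<^bsub>R i\<^esub> x i) \<oplus>\<^bsub>?P\<^esub> x = \<zero>\<^bsub>?P\<^esub>"
        unfolding ops by (intro restrict_ext) (simp add: cr(9) mem x)
      moreover have "(\<lambda>i\<in>I. \<ominus>\<^bsub>R i\<^esub> x i) \<in> carrier ?P"
        by (intro carI cr(3) mem x)
      ultimately show "\<exists>y\<in>carrier ?P. y \<oplus>\<^bsub>?P\<^esub> x = \<zero>\<^bsub>?P\<^esub>"
        by blast
      fix y assume y: "y \<in> carrier ?P"
      show "x \<oplus>\<^bsub>?P\<^esub> y \<in> carrier ?P" by (rule addcl[OF x y])
      show "x \<oplus>\<^bsub>?P\<^esub> y = y \<oplus>\<^bsub>?P\<^esub> x"
        unfolding ops by (intro restrict_ext) (rule cr(10); simp add: mem x y)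
      fix z assume z: "z \<in> carrier ?P"
      show "x \<oplus>\<^bsub>?P\<^esub> y \<oplus>\<^bsub>?P\<^esub> z = x \<oplus>\<^bsub>?P\<^esub> (y \<oplus>\<^bsub>?P\<^esub> z)"
        unfolding ops by (intro restrict_ext) (simp add: cr(7) mem x y z)
    qed
    show "Group.comm_monoid ?P"
    proof (rule comm_monoidI)
      show "\<one>\<^bsub>?P\<^esub> \<in> carrier ?P"
        unfolding ops by (intro carI cr(6))
      fix x assume x: "x \<in> carrier ?P"
      show "\<one>\<^bsub>?P\<^esub> \<otimes>\<^bsub>?P\<^esub> x = x"
      proof -
        have "\<one>\<^bsub>?P\<^esub> \<otimes>\<^bsub>?P\<^esub> x = (\<lambda>i\<in>I. x i)"
          unfolding ops by (intro restrict_ext) (simp add: cr(12) mem x)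
        then show ?thesis using restr[OF x] by simp
      qed
      fix y assume y: "y \<in> carrier ?P"
      show "x \<otimes>\<^bsub>?P\<^esub> y \<in> carrier ?P" by (rule mulcl[OF x y])
      show "x \<otimes>\<^bsub>?P\<^esub> y = y \<otimes>\<^bsub>?P\<^esub> x"
        unfolding ops by (intro restrict_ext) (rule cr(14); simp add: mem x y)
      fix z assume z: "z \<in> carrier ?P"
      show "x \<otimes>\<^bsub>?P\<^esub> y \<otimes>\<^bsub>?P\<^esub> z = x \<otimes>\<^bsub>?P\<^esub> (y \<otimes>\<^bsub>?P\<^esub> z)"
        unfolding ops by (intro restrict_ext) (simp add: cr(11) mem x y z)
    qed
    fix x y z assume x: "x \<in> carrier ?P" and y: "y \<in> carrier ?P" and z: "z \<in> carrier ?P"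
    show "(x \<oplus>\<^bsub>?P\<^esub> y) \<otimes>\<^bsub>?P\<^esub> z = x \<otimes>\<^bsub>?P\<^esub> z \<oplus>\<^bsub>?P\<^esub> y \<otimes>\<^bsub>?P\<^esub> z"
      unfolding ops by (intro restrict_ext) (simp add: cr(13) mem x y z)
  qed
qed

lemma cring_Zmod: "prime p \<Longrightarrow> cring (Zmod p)"
  using residues.cring[of "int p"] prime_gt_1_nat[of p] by (simp add: residues_def)

lemma cring_prod_Zp: "cring prod_Zp"
  unfolding prod_Zp_def by (rule cring_product_ring) (simp add: cring_Zmod)

lemma prod_Zp_simps:
  "carrier prod_Zp = (\<Pi>\<^sub>E p\<in>primes. {0..int p - 1})"
  "x \<oplus>\<^bsub>prod_Zp\<^esub> y = (\<lambda>p\<in>primes. (x p + y p) mod int p)"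
  "x \<otimes>\<^bsub>prod_Zp\<^esub> y = (\<lambda>p\<in>primes. (x p * y p) mod int p)"
  "\<one>\<^bsub>prod_Zp\<^esub> = (\<lambda>p\<in>primes. 1)"
  "\<zero>\<^bsub>prod_Zp\<^esub> = (\<lambda>p\<in>primes. 0)"
  by (simp_all add: prod_Zp_def product_ring_def residue_ring_def)

lemma sum_Zp_eq: "sum_Zp = {x \<in> carrier prod_Zp. finite {p. prime p \<and> x p \<noteq> 0}}"
  by (simp add: sum_Zp_def direct_sum_def prod_Zp_def residue_ring_def)

lemma reduce_in_prod_Zp: "(\<lambda>p\<in>primes. x p mod int p) \<in> carrier prod_Zp"
  by (auto simp: prod_Zp_simps prime_gt_0_nat)

lemma a_inv_prod_Zp:
  assumes "x \<in> carrier prod_Zp"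
  shows "\<ominus>\<^bsub>prod_Zp\<^esub> x = (\<lambda>p\<in>primes. (- x p) mod int p)"
proof -
  interpret cring prod_Zp by (rule cring_prod_Zp)
  have "(\<lambda>p\<in>primes. (- x p) mod int p) \<oplus>\<^bsub>prod_Zp\<^esub> x = \<zero>\<^bsub>prod_Zp\<^esub>"
    by (auto simp: prod_Zp_simps fun_eq_iff mod_add_left_eq)
  then show ?thesis
    by (rule minus_equality) (rule assms, rule reduce_in_prod_Zp)
qed

lemma ideal_sum_Zp: "ideal sum_Zp prod_Zp"
proof -
  interpret cring prod_Zp by (rule cring_prod_Zp)
  have mem: "x \<in> sum_Zp \<longleftrightarrow> x \<in> carrier prod_Zp \<and> finite {p. prime p \<and> x p \<noteq> 0}" for x
    by (auto simp: sum_Zp_eq)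
  have add: "x \<oplus>\<^bsub>prod_Zp\<^esub> y \<in> sum_Zp" if "x \<in> sum_Zp" "y \<in> sum_Zp" for x y
  proof -
    have "{p. prime p \<and> (x \<oplus>\<^bsub>prod_Zp\<^esub> y) p \<noteq> 0} \<subseteq> {p. prime p \<and> x p \<noteq> 0} \<union> {p. prime p \<and> y p \<noteq> 0}"
      by (auto simp: prod_Zp_simps)
    then show ?thesis
      using that by (auto simp: mem intro: finite_subset)
  qed
  have mult: "x \<otimes>\<^bsub>prod_Zp\<^esub> y \<in> sum_Zp" if "x \<in> sum_Zp" "y \<in> carrier prod_Zp" for x y
  proof -
    have "{p. prime p \<and> (x \<otimes>\<^bsub>prod_Zp\<^esub> y) p \<noteq> 0} \<subseteq> {p. prime p \<and> x p \<noteq> 0}"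
      by (auto simp: prod_Zp_simps)
    then show ?thesis
      using that by (auto simp: mem intro: finite_subset)
  qed
  have neg: "\<ominus>\<^bsub>prod_Zp\<^esub> x \<in> sum_Zp" if "x \<in> sum_Zp" for x
  proof -
    have "{p. prime p \<and> (\<ominus>\<^bsub>prod_Zp\<^esub> x) p \<noteq> 0} \<subseteq> {p. prime p \<and> x p \<noteq> 0}"
      using that by (auto simp: mem a_inv_prod_Zp)
    then show ?thesis
      using that by (auto simp: mem intro: finite_subset)
  qed
  have zero: "\<zero>\<^bsub>prod_Zp\<^esub> \<in> sum_Zp"
    by (simp add: mem) (simp add: prod_Zp_simps)
  show ?thesis
  proof (rule idealI)
    show "subgroup sum_Zp (add_monoid prod_Zp)"
    proof (rule add.subgroupI)
      show "sum_Zp \<subseteq> carrier prod_Zp" by (auto simp: mem)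
      show "sum_Zp \<noteq> {}" using zero by blast
      show "\<ominus>\<^bsub>prod_Zp\<^esub> x \<in> sum_Zp" if "x \<in> sum_Zp" for x
        by (rule neg[OF that])
      show "x \<oplus>\<^bsub>prod_Zp\<^esub> y \<in> sum_Zp" if "x \<in> sum_Zp" "y \<in> sum_Zp" for x y
        by (rule add[OF that])
    qed
    show "x \<otimes>\<^bsub>prod_Zp\<^esub> a \<in> sum_Zp" if "a \<in> sum_Zp" "x \<in> carrier prod_Zp" for a x
    proof -
      have "x \<otimes>\<^bsub>prod_Zp\<^esub> a = a \<otimes>\<^bsub>prod_Zp\<^esub> x"
        using that by (intro m_comm) (auto simp: mem)
      then show ?thesis using mult[OF that] by simp
    qed
  qed (rule ring_axioms, rule mult)
qed

lemma cring_ringA: "cring \<A>"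
  unfolding ringA_def by (rule ideal.quotient_is_cring[OF ideal_sum_Zp cring_prod_Zp])

lemma class_A_closed: "class_A x \<in> carrier \<A>"
proof -
  interpret ideal sum_Zp prod_Zp by (rule ideal_sum_Zp)
  show ?thesis
    unfolding class_A_def ringA_def FactRing_def
    using a_rcosetsI[OF a_subset reduce_in_prod_Zp] by simp
qed

lemma class_A_eq_iff:
  "class_A x = class_A y \<longleftrightarrow> finite {p. prime p \<and> \<not> [x p = y p] (mod int p)}"
proof -
  let ?r = "\<lambda>x. \<lambda>p\<in>primes. x p mod int p"
  have "class_A x = class_A y \<longleftrightarrow> ?r x \<ominus>\<^bsub>prod_Zp\<^esub> ?r y \<in> sum_Zp"
    unfolding class_A_def
    using ring.quotient_eq_iff_same_a_r_cos[OF cring.axioms(1)[OF cring_prod_Zp]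
        ideal_sum_Zp reduce_in_prod_Zp reduce_in_prod_Zp]
    by blast
  also have "?r x \<ominus>\<^bsub>prod_Zp\<^esub> ?r y = ?r (\<lambda>p. x p - y p)"
    by (auto simp: a_minus_def a_inv_prod_Zp[OF reduce_in_prod_Zp] prod_Zp_simps(2) fun_eq_iff
        mod_simps)
  also have "\<dots> \<in> sum_Zp \<longleftrightarrow> finite {p. prime p \<and> \<not> [x p = y p] (mod int p)}"
  proof -
    define z where "z = ?r (\<lambda>p. x p - y p)"
    have "{p. prime p \<and> z p \<noteq> 0} = {p. prime p \<and> \<not> [x p = y p] (mod int p)}"
      by (auto simp: z_def cong_iff_dvd_diff mod_eq_0_iff_dvd)
    moreover have "z \<in> carrier prod_Zp"
      unfolding z_def by (rule reduce_in_prod_Zp)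
    ultimately have "z \<in> sum_Zp \<longleftrightarrow> finite {p. prime p \<and> \<not> [x p = y p] (mod int p)}"
      by (simp add: sum_Zp_eq)
    then show ?thesis
      unfolding z_def .
  qed
  finally show ?thesis .
qed

definition indices :: "nat \<Rightarrow> nat \<Rightarrow> nat list set" where
  "indices r N = {ks. length ks = r \<and> (\<forall>k\<in>set ks. 0 < k) \<and> sum_list ks = N}"

lemma finite_indices: "finite (indices r N)"
proof (rule finite_subset)
  show "indices r N \<subseteq> {ks. set ks \<subseteq> {..N} \<and> length ks = r}"
    by (auto simp: indices_def dest: member_le_sum_list)
qed (simp add: finite_lists_length_eq)

text \<open>The list \<open>ms\<close> below stands for \<open>(m\<^sub>1, \<dots>, m\<^sub>r)\<close>; list positions start at \<open>0\<close>.\<close>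

definition M_N :: "nat \<Rightarrow> nat list \<Rightarrow> int list \<Rightarrow> rat" where
  "M_N N ks es =
    (\<Sum>ms | length ms = length ks \<and> sorted_wrt (<) ms \<and> (\<forall>m\<in>set ms. 0 < m \<and> m < N).
       (\<Prod>i<length ks. 1 + of_int (es ! i) * (-1) ^ (ms ! i)) /
       (\<Prod>i<length ks. of_nat (ms ! i) ^ (ks ! i)))"

text \<open>
  Reduction modulo \<open>p\<close> of a rational number whose denominator in lowest terms is coprime to
  \<open>p\<close>. The denominators of \<open>M_N p ks es\<close> have this property for every prime \<open>p\<close>.
\<close>

definition rat_mod :: "rat \<Rightarrow> int \<Rightarrow> int" where
  "rat_mod x p = (case quotient_of x of (u, v) \<Rightarrow> (u * modular_inverse p v) mod p)"

lemma rat_mod_fraction: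
  assumes "coprime v p" "v \<noteq> 0"
  shows "[v * rat_mod (of_int u / of_int v) p = u] (mod p)"
proof -
  obtain u' v' where q: "quotient_of (of_int u / of_int v) = (u', v')"
    by fastforce
  have pos: "v' > 0" and cop: "coprime u' v'"
    using q quotient_of_denom_pos quotient_of_coprime by blast+
  have "(of_int u / of_int v :: rat) = of_int u' / of_int v'"
    using quotient_of_div[OF q] .
  then have "(of_int (u * v') :: rat) = of_int (u' * v)"
    using pos assms(2) by (simp add: field_simps)
  then have e: "u * v' = u' * v"
    by linarith
  then have "v' dvd u' * v"
    by (metis dvd_triv_right)
  then have "v' dvd v"
    using cop by (simp add: coprime_commute coprime_dvd_mult_right_iff)
  then have c: "coprime v' p"
    using assms(1) by (meson coprime_divisors dvd_refl)
  have "[v * rat_mod (of_int u / of_int v) p = v * (u' * modular_inverse p v')] (mod p)"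
    by (simp add: rat_mod_def q cong_def mod_mult_right_eq)
  also have "v * (u' * modular_inverse p v') = u * (v' * modular_inverse p v')"
    using e by (simp add: algebra_simps)
  also have "[\<dots> = u * 1] (mod p)"
    by (intro cong_mult cong_refl cong_modular_inverse1 c)
  finally show ?thesis by simp
qed

definition M_A :: "nat list \<Rightarrow> int list \<Rightarrow> (nat \<Rightarrow> int) set" ("M\<^sub>\<A>") where
  "M\<^sub>\<A> ks es = class_A (\<lambda>p. rat_mod (M_N p ks es) (int p))"

lemma M_A_closed: "M\<^sub>\<A> ks es \<in> carrier \<A>"
  by (simp add: M_A_def class_A_closed)

end

(* With y recording the excess of weight over depth, the sum over strictly increasing chains ending at
   q is the q-th coefficient of a power series G solving an equation (theta - y) G = e_delta + x e_tau G,
   where theta is the Euler operator and e_delta collects the steps of parity delta. The Leibniz rule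
   for theta applied to a product of two such series G H yields chains for (x + u, y + v) started
   either by e_delta2 G or by e_delta1 H; extracting coefficients produces the binomial coefficients and
   hence, over the rationals, the left-hand side as a convolution sum over q + q' < p. Reflecting the
   indices of the second factor, r -> p - r, turns this modulo an odd prime p into the right-hand
   side: r^k picks up (-1)^k and (-1)^r changes sign. *)

theory Submission
  imports Defs "HOL-Computational_Algebra.Formal_Power_Series"
begin

section \<open>Power series: the inverse Euler operator and chain series\<close>

unbundle fps_syntax

text \<open>Inverse of the Euler operator \<open>f \<mapsto> X f'\<close> on series without constant term; division by
  zero kills the constant term.\<close>

definition fps_euler_int :: "'a::field_char_0 fps \<Rightarrow> 'a fps" where
  "fps_euler_int f = Abs_fps (\<lambda>n. f $ n / of_nat n)"

lemma fps_euler_int_nth [simp]: "fps_euler_int f $ n = f $ n / of_nat n"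
  by (simp add: fps_euler_int_def)

lemma fps_euler_int_add: "fps_euler_int (f + g) = fps_euler_int f + fps_euler_int g"
  by (simp add: fps_eq_iff add_divide_distrib)

lemma fps_euler_int_sum: "fps_euler_int (sum f S) = (\<Sum>i\<in>S. fps_euler_int (f i))"
  by (simp add: fps_eq_iff fps_sum_nth sum_divide_distrib)

lemma fps_euler_int_of_nat_mult: "fps_euler_int (of_nat c * f) = of_nat c * fps_euler_int f"
  by (simp add: fps_eq_iff fps_mult_of_nat_nth)

lemma fps_euler_int_funpow_nth: "(fps_euler_int ^^ k) f $ n = f $ n / of_nat n ^ k"
  by (induction k) (auto simp: field_simps)

lemma fps_euler_int_funpow_sum:
  "(fps_euler_int ^^ k) (sum f S) = (\<Sum>i\<in>S. (fps_euler_int ^^ k) (f i))"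
  by (simp add: fps_eq_iff fps_euler_int_funpow_nth fps_sum_nth sum_divide_distrib)

text \<open>Integrated Leibniz rule: with F and G the integrals of \<open>f\<close> and
  \<open>g\<close>, the Euler operator maps F G to f G + g F. On coefficients this is 1/(i d) = (1/i
  + 1/d)/(i + d).\<close>

lemma fps_euler_int_mult:
  assumes "f $ 0 = 0" "g $ 0 = 0"
  shows "fps_euler_int f * fps_euler_int g =
    fps_euler_int (f * fps_euler_int g + g * fps_euler_int f)"
proof (rule fps_ext)
  fix n
  have "f $ i / of_nat i * (g $ (n - i) / of_nat (n - i)) =
      (f $ i * (g $ (n - i) / of_nat (n - i)) + f $ i / of_nat i * g $ (n - i)) / of_nat n"
    if "i \<le> n" for i
  \<comment> \<open>At both ends a division by zero returns 0, and the vanishing constant terms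
    remove what is left.\<close>
  proof (cases "i = 0 \<or> i = n")
    case False
    define d where "d = n - i"
    with that False have n: "n = i + d" and "i \<noteq> 0" "d \<noteq> 0"
      by auto
    then have "(of_nat i + of_nat d :: 'a) \<noteq> 0"
      by (metis add_is_0 of_nat_add of_nat_eq_0_iff)
    then show ?thesis
      using \<open>i \<noteq> 0\<close> \<open>d \<noteq> 0\<close> by (simp add: n divide_simps) (simp add: algebra_simps)
  qed (use assms in auto)
  then have "(fps_euler_int f * fps_euler_int g) $ n =
      (\<Sum>i=0..n. (f $ i * (g $ (n - i) / of_nat (n - i)) + f $ i / of_nat i * g $ (n - i)) / of_nat n)"
    by (simp add: fps_mult_nth)
  also have "\<dots> = fps_euler_int (f * fps_euler_int g + fps_euler_int f * g) $ n"
    by (simp add: fps_mult_nth sum.distrib flip: sum_divide_distrib)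
  finally show "(fps_euler_int f * fps_euler_int g) $ n =
      fps_euler_int (f * fps_euler_int g + g * fps_euler_int f) $ n"
    by (simp add: mult.commute)
qed

text \<open>Generating series, by last element, of chains with \<open>i + 1\<close> elements and excess weight \<open>j\<close>:
  \<open>f\<close> governs the first element and \<open>e\<close> the later differences.\<close>

primrec chain_fps :: "'a::field_char_0 fps \<Rightarrow> 'a fps \<Rightarrow> nat \<Rightarrow> nat \<Rightarrow> 'a fps" where
  "chain_fps e f 0 j = (fps_euler_int ^^ Suc j) f"
| "chain_fps e f (Suc i) j = (\<Sum>t\<le>j. (fps_euler_int ^^ Suc t) (e * chain_fps e f i (j - t)))"

lemma chain_fps_nth_0: "chain_fps e f i j $ 0 = 0"
  by (cases i) (auto simp: fps_sum_nth)

text \<open>Comparison of coefficients of x^i y^j in (theta - y) G = f + x e G, followed by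
  integration. In the definition the term t = 0 is the step with \<open>e\<close>; the terms t > 0
  are one more integration of the series of excess \<open>j - 1\<close>.\<close>

lemma chain_fps_rec:
  "chain_fps e f i j = fps_euler_int (
     (if j = 0 then 0 else chain_fps e f i (j - 1)) +
     e * (if i = 0 then 0 else chain_fps e f (i - 1) j) +
     (if i = 0 \<and> j = 0 then f else 0))"
proof (cases i)
  case 0
  then show ?thesis by (cases j) auto
next
  case (Suc i')
  show ?thesis
  proof (cases j)
    case 0
    then show ?thesis using Suc by simp
  next
    case (Suc j')
    then show ?thesis using \<open>i = Suc i'\<close>
      by (simp add: sum.atMost_Suc_shift fps_euler_int_add fps_euler_int_sum
          del: sum.atMost_Suc)
  qed
qed

lemma chain_fps_sum: "chain_fps e (sum f S) i j = (\<Sum>x\<in>S. chain_fps e (f x) i j)"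
proof (induction i arbitrary: j)
  case 0
  then show ?case by (simp add: fps_euler_int_funpow_sum fps_euler_int_sum)
next
  case (Suc i)
  then show ?case
    by (simp add: sum_distrib_left fps_euler_int_funpow_sum fps_euler_int_sum sum.swap[of _ S])
qed

section \<open>Binomially weighted chain sums and the product formula\<close>

text \<open>Multiplication by y + v in coefficients: y^n' v^n is reached from y^(n'-1) v^n and from
  y^n' v^(n-1). After shifting \<open>j\<close> this is Pascal's rule; for n' = 0 the first sum
  drops out because every \<open>j\<close> in it is below \<open>n\<close>.\<close>

lemma sum_choose_shift:
  fixes g :: "nat \<Rightarrow> 'a::comm_semiring_1"
  shows "(\<Sum>j\<le>n' + n. of_nat (j choose n) * (if j = 0 then 0 else g (j - 1))) =
    (if n' = 0 then 0 else \<Sum>j\<le>n' - 1 + n. of_nat (j choose n) * g j) +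
    (if n = 0 then 0 else \<Sum>j\<le>n' + (n - 1). of_nat (j choose (n - 1)) * g j)"
proof (cases "n' + n")
  case 0
  then show ?thesis by simp
next
  case (Suc B)
  have "(\<Sum>j\<le>n' + n. of_nat (j choose n) * (if j = 0 then 0 else g (j - 1))) =
      (\<Sum>j\<le>B. of_nat (Suc j choose n) * g j)"
    unfolding Suc by (subst sum.atMost_Suc_shift) simp
  also have "\<dots> = (\<Sum>j\<le>B. of_nat (j choose n) * g j) +
      (if n = 0 then 0 else \<Sum>j\<le>B. of_nat (j choose (n - 1)) * g j)"
    by (cases n) (auto simp: sum.distrib algebra_simps)
  also have "(\<Sum>j\<le>B. of_nat (j choose n) * g j) =
      (if n' = 0 then 0 else \<Sum>j\<le>n' - 1 + n. of_nat (j choose n) * g j)"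
  proof (cases n')
    case 0
    then have "(\<Sum>j\<le>B. of_nat (j choose n) * g j) = 0"
      using Suc by (intro sum.neutral) (auto simp: binomial_eq_0)
    then show ?thesis using 0 by simp
  next
    case (Suc n'')
    then show ?thesis using \<open>n' + n = Suc B\<close> by simp
  qed
  also have "(if n = 0 then 0 else \<Sum>j\<le>B. of_nat (j choose (n - 1)) * g j) =
      (if n = 0 then 0 else \<Sum>j\<le>n' + (n - 1). of_nat (j choose (n - 1)) * g j)"
    using Suc by (cases n) auto
  finally show ?thesis .
qed

text \<open>The coefficient of x^m' u^m y^n' v^n in the chain series at (x + u, y + v) whose initial
  series F(x, y) has the coefficients \<open>F i j\<close>. The binomials come from expanding (x +
  u)^i and (y + v)^j.\<close>

definition chain_sum ::
    "'a::field_char_0 fps \<Rightarrow> (nat \<Rightarrow> nat \<Rightarrow> 'a fps) \<Rightarrow> nat \<Rightarrow> nat \<Rightarrow> nat \<Rightarrow> nat \<Rightarrow> 'a fps" where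
  "chain_sum e F m' m n' n =
    (\<Sum>i\<le>m' + m. \<Sum>j\<le>n' + n. of_nat (i choose m) * (of_nat (j choose n) *
       chain_fps e (F (m' + m - i) (n' + n - j)) i j))"

text \<open>Coefficient form of (theta - (y + v)) K = (x + u) e K + F. As F involves neither u nor
  v, it contributes only for m = n = 0.\<close>

lemma chain_sum_rec:
  "chain_sum e F m' m n' n = fps_euler_int (
     (if n' = 0 then 0 else chain_sum e F m' m (n' - 1) n) +
     (if n = 0 then 0 else chain_sum e F m' m n' (n - 1)) +
     e * ((if m' = 0 then 0 else chain_sum e F (m' - 1) m n' n) +
          (if m = 0 then 0 else chain_sum e F m' (m - 1) n' n)) +
     (if m = 0 \<and> n = 0 then F m' n' else 0))"
proof -
  \<comment> \<open>\<open>A\<close> and \<open>B\<close> stand for the totals \<open>m' + m\<close>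
    and \<open>n' + n\<close>. Lowering \<open>A\<close> together with \<open>i\<close>, or
    \<open>B\<close> together with \<open>j\<close>, leaves the arguments of \<open>F\<close>
    unchanged, so the recursion stays inside one family.\<close>
  define X where "X = (\<lambda>A B i j. chain_fps e (F (A - i) (B - j)) i j)"
  have S: "chain_sum e F m' m n' n =
    (\<Sum>i\<le>m' + m. of_nat (i choose m) * (\<Sum>j\<le>n' + n. of_nat (j choose n) * X (m' + m) (n' + n) i j))"
    for m' m n' n by (simp add: chain_sum_def X_def sum_distrib_left)
  \<comment> \<open>The shift in \<open>j\<close> needs the sum over \<open>j\<close> innermost, the
    shift in \<open>i\<close> the sum over \<open>i\<close>; hence both orders.\<close>
  have S': "chain_sum e F m' m n' n =
    (\<Sum>j\<le>n' + n. of_nat (j choose n) * (\<Sum>i\<le>m' + m. of_nat (i choose m) * X (m' + m) (n' + n) i j))"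
    for m' m n' n
    unfolding chain_sum_def X_def sum_distrib_left
    by (subst sum.swap) (simp only: mult.left_commute)
  have X: "X A B i j = fps_euler_int (
     (if j = 0 then 0 else X A (B - 1) i (j - 1)) +
     e * (if i = 0 then 0 else X (A - 1) B (i - 1) j) +
     (if i = 0 \<and> j = 0 then F A B else 0))" for A B i j
    unfolding X_def by (subst chain_fps_rec) (auto simp: diff_diff_left)
  have "chain_sum e F m' m n' n = fps_euler_int (
     (\<Sum>i\<le>m' + m. of_nat (i choose m) * (\<Sum>j\<le>n' + n. of_nat (j choose n) *
       (if j = 0 then 0 else X (m' + m) (n' + n - 1) i (j - 1)))) +
     e * (\<Sum>j\<le>n' + n. of_nat (j choose n) * (\<Sum>i\<le>m' + m. of_nat (i choose m) *
       (if i = 0 then 0 else X (m' + m - 1) (n' + n) (i - 1) j))) +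
     (\<Sum>i\<le>m' + m. \<Sum>j\<le>n' + n. of_nat (i choose m) * (of_nat (j choose n) *
       (if i = 0 \<and> j = 0 then F (m' + m) (n' + n) else 0))))"
    (is "_ = fps_euler_int (?U + e * ?V + ?W)")
  proof -
    have "e * ?V = (\<Sum>i\<le>m' + m. \<Sum>j\<le>n' + n. of_nat (i choose m) * (of_nat (j choose n) *
       (e * (if i = 0 then 0 else X (m' + m - 1) (n' + n) (i - 1) j))))"
      by (subst sum.swap) (simp add: sum_distrib_left mult_ac)
    moreover have "?U = (\<Sum>i\<le>m' + m. \<Sum>j\<le>n' + n. of_nat (i choose m) * (of_nat (j choose n) *
       (if j = 0 then 0 else X (m' + m) (n' + n - 1) i (j - 1))))"
      by (simp add: sum_distrib_left)
    moreover have "chain_sum e F m' m n' n =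
      (\<Sum>i\<le>m' + m. \<Sum>j\<le>n' + n. of_nat (i choose m) * (of_nat (j choose n) *
        fps_euler_int (
         (if j = 0 then 0 else X (m' + m) (n' + n - 1) i (j - 1)) +
         e * (if i = 0 then 0 else X (m' + m - 1) (n' + n) (i - 1) j) +
         (if i = 0 \<and> j = 0 then F (m' + m) (n' + n) else 0))))"
      unfolding chain_sum_def X[symmetric] by (simp only: X_def)
    ultimately show ?thesis
      by (simp only: fps_euler_int_add fps_euler_int_sum fps_euler_int_of_nat_mult
          distrib_left sum.distrib)
  qed
  also have "?U = (if n' = 0 then 0 else chain_sum e F m' m (n' - 1) n) +
     (if n = 0 then 0 else chain_sum e F m' m n' (n - 1))"
    unfolding sum_choose_shift[where n' = n' and n = n and g = "X (m' + m) (n' + n - 1) i" for i] S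
    by (cases n'; cases n) (simp_all add: sum.distrib distrib_left)
  also have "?V = (if m' = 0 then 0 else chain_sum e F (m' - 1) m n' n) +
          (if m = 0 then 0 else chain_sum e F m' (m - 1) n' n)"
    unfolding sum_choose_shift[where n' = m' and n = m and g = "\<lambda>i. X (m' + m - 1) (n' + n) i j" for j] S'
    by (cases m'; cases m) (simp_all add: sum.distrib distrib_left)
  also have "?W = (if m = 0 \<and> n = 0 then F m' n' else 0)"
  proof -
    have at_0: "(\<Sum>i\<le>N. h i) = h 0" if "\<And>i. i \<noteq> 0 \<Longrightarrow> h i = 0" for N :: nat and h :: "nat \<Rightarrow> 'a fps"
      using that by (intro trans[OF sum.mono_neutral_right[of "{..N}" "{0}" h]]) auto
    have "?W = of_nat (0 choose m) * (of_nat (0 choose n) * F (m' + m) (n' + n))"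
      by (subst at_0, simp, subst at_0) auto
    then show ?thesis by (auto simp: binomial_eq_0)
  qed
  finally show ?thesis .
qed

text \<open>Let G(x, y) and H(u, v) be the chain series started by \<open>f\<close> and
  \<open>g\<close>. By the Leibniz rule G H obeys the recursion of the two chain sums added
  together, with initial terms g G and f H, so induction on the total degree applies. The second sum
  has its arguments swapped because f H lives in u, v instead of x, y.\<close>

lemma chain_fps_shuffle:
  assumes "e $ 0 = 0" "f $ 0 = 0" "g $ 0 = 0"
  shows "chain_sum e (\<lambda>i j. g * chain_fps e f i j) m' m n' n +
      chain_sum e (\<lambda>i j. f * chain_fps e g i j) m m' n n' =
    chain_fps e f m' n' * chain_fps e g m n"
proof (induction "m' + m + n' + n" arbitrary: m' m n' n rule: less_induct)
  case less
  let ?T = "chain_sum e (\<lambda>i j. g * chain_fps e f i j)"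
  let ?S = "chain_sum e (\<lambda>i j. f * chain_fps e g i j)"
  let ?P = "chain_fps e f" and ?Q = "chain_fps e g"
  define A where "A = (if n' = 0 then 0 else ?P m' (n' - 1)) +
    e * (if m' = 0 then 0 else ?P (m' - 1) n') + (if m' = 0 \<and> n' = 0 then f else 0)"
  define B where "B = (if n = 0 then 0 else ?Q m (n - 1)) +
    e * (if m = 0 then 0 else ?Q (m - 1) n) + (if m = 0 \<and> n = 0 then g else 0)"
  have P: "?P m' n' = fps_euler_int A"
    unfolding A_def by (rule chain_fps_rec)
  have Q: "?Q m n = fps_euler_int B"
    unfolding B_def by (rule chain_fps_rec)
  have "A $ 0 = 0" "B $ 0 = 0"
    using assms by (auto simp: A_def B_def chain_fps_nth_0)
  then have "?P m' n' * ?Q m n = fps_euler_int (A * ?Q m n + B * ?P m' n')"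
    unfolding P Q by (rule fps_euler_int_mult)
  \<comment> \<open>Apart from the two initial terms, four products remain, each of total degree one
    less: the induction hypothesis splits every one of them.\<close>
  also have "A * ?Q m n + B * ?P m' n' =
     (if n' = 0 then 0 else ?P m' (n' - 1) * ?Q m n) +
     (if n = 0 then 0 else ?P m' n' * ?Q m (n - 1)) +
     e * ((if m' = 0 then 0 else ?P (m' - 1) n' * ?Q m n) +
          (if m = 0 then 0 else ?P m' n' * ?Q (m - 1) n)) +
     (if m = 0 \<and> n = 0 then g * ?P m' n' else 0) +
     (if m' = 0 \<and> n' = 0 then f * ?Q m n else 0)"
    by (simp add: A_def B_def algebra_simps)
  also have "(if n' = 0 then 0 else ?P m' (n' - 1) * ?Q m n) =
      (if n' = 0 then 0 else ?T m' m (n' - 1) n) + (if n' = 0 then 0 else ?S m m' n (n' - 1))"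
    using less[of m' m "n' - 1" n] by auto
  also have "(if n = 0 then 0 else ?P m' n' * ?Q m (n - 1)) =
      (if n = 0 then 0 else ?T m' m n' (n - 1)) + (if n = 0 then 0 else ?S m m' (n - 1) n')"
    using less[of m' m n' "n - 1"] by auto
  also have "(if m' = 0 then 0 else ?P (m' - 1) n' * ?Q m n) =
      (if m' = 0 then 0 else ?T (m' - 1) m n' n) + (if m' = 0 then 0 else ?S m (m' - 1) n n')"
    using less[of "m' - 1" m n' n] by auto
  also have "(if m = 0 then 0 else ?P m' n' * ?Q (m - 1) n) =
      (if m = 0 then 0 else ?T m' (m - 1) n' n) + (if m = 0 then 0 else ?S (m - 1) m' n n')"
    using less[of m' "m - 1" n' n] by auto
  finally show ?case
    by (subst (1 2) chain_sum_rec) (simp add: algebra_simps flip: fps_euler_int_add)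
qed

section \<open>Truncated mixed values as coefficients of power series\<close>

definition parity_weight :: "int \<Rightarrow> nat \<Rightarrow> nat \<Rightarrow> rat" where
  "parity_weight \<epsilon> k q = (1 + of_int \<epsilon> * (-1) ^ q) / of_nat q ^ k"

lemma M_N_Nil [simp]: "M_N N [] es = 1"
proof -
  have "{ms. length ms = length ([]::nat list) \<and> sorted_wrt (<) ms \<and> (\<forall>m\<in>set ms. 0 < m \<and> m < N)} = {[]}"
    by auto
  then show ?thesis by (simp only: M_N_def) simp
qed

text \<open>Once the largest summation index \<open>q\<close> is fixed, the others form an arbitrary
  chain strictly below \<open>q\<close>, which is again a truncated sum.\<close>

lemma M_N_snoc:
  assumes "length es = length ks"
  shows "M_N N (ks @ [k]) (es @ [\<epsilon>]) = (\<Sum>q\<in>{0<..<N}. parity_weight \<epsilon> k q * M_N q ks es)"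
proof -
  define S where "S = (\<lambda>r N. {ms::nat list. length ms = r \<and> sorted_wrt (<) ms \<and> (\<forall>m\<in>set ms. 0 < m \<and> m < N)})"
  define t where "t = (\<lambda>ks es ms. (\<Prod>i<length ks. 1 + of_int (es ! i) * (-1) ^ (ms ! i)) /
       (\<Prod>i<length ks. of_nat (ms ! i) ^ (ks ! i)) :: rat)"
  have M: "M_N N ks es = (\<Sum>ms\<in>S (length ks) N. t ks es ms)" for N ks es
    by (simp add: M_N_def S_def t_def)
  have fin: "finite (S r q)" for r q
    by (rule finite_subset[of _ "{ms. set ms \<subseteq> {..<q} \<and> length ms = r}"])
      (auto simp: S_def finite_lists_length_eq)
  have "M_N N (ks @ [k]) (es @ [\<epsilon>]) =
      (\<Sum>(q, ms)\<in>Sigma {0<..<N} (S (length ks)). t (ks @ [k]) (es @ [\<epsilon>]) (ms @ [q]))"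
    unfolding M
  proof (rule sum.reindex_bij_witness[where j = "\<lambda>ms. (last ms, butlast ms)" and i = "\<lambda>(q, ms). ms @ [q]"])
    fix ms assume ms: "ms \<in> S (length (ks @ [k])) N"
    then have "ms \<noteq> []" by (auto simp: S_def)
    then obtain ms' q where *: "ms = ms' @ [q]" by (metis append_butlast_last_id)
    show "(case (last ms, butlast ms) of (q, ms) \<Rightarrow> ms @ [q]) = ms" using * by simp
    show "(last ms, butlast ms) \<in> Sigma {0<..<N} (S (length ks))"
      using ms * by (auto simp: S_def sorted_wrt_append)
    show "(case (last ms, butlast ms) of (q, ms') \<Rightarrow> t (ks @ [k]) (es @ [\<epsilon>]) (ms' @ [q])) =
        t (ks @ [k]) (es @ [\<epsilon>]) ms" using * by simp
  next
    fix x assume "x \<in> Sigma {0<..<N} (S (length ks))"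
    then show "(case x of (q, ms) \<Rightarrow> ms @ [q]) \<in> S (length (ks @ [k])) N"
      by (force simp: S_def sorted_wrt_append)
    show "(last (case x of (q, ms) \<Rightarrow> ms @ [q]), butlast (case x of (q, ms) \<Rightarrow> ms @ [q])) = x"
      by (cases x) simp
  qed
  also have "\<dots> = (\<Sum>(q, ms)\<in>Sigma {0<..<N} (S (length ks)). parity_weight \<epsilon> k q * t ks es ms)"
  proof (intro sum.cong refl, clarify)
    fix q ms assume "ms \<in> S (length ks) q"
    then have "length ms = length ks" by (simp add: S_def)
    then show "t (ks @ [k]) (es @ [\<epsilon>]) (ms @ [q]) = parity_weight \<epsilon> k q * t ks es ms"
      using assms by (simp add: t_def parity_weight_def nth_append mult.commute)
  qed
  also have "\<dots> = (\<Sum>q\<in>{0<..<N}. \<Sum>ms\<in>S (length ks) q. parity_weight \<epsilon> k q * t ks es ms)"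
    by (rule sum.Sigma[symmetric]) (auto simp: fin)
  finally show ?thesis by (simp add: M sum_distrib_left)
qed

text \<open>For a sign \<open>\<epsilon>\<close>, the series of admissible differences of
  consecutive summation indices: weight 2 where (-1)^d equals \<open>\<epsilon>\<close>, and no
  constant term since the indices increase strictly.\<close>

definition step_fps :: "int \<Rightarrow> rat fps" where
  "step_fps \<epsilon> = Abs_fps (\<lambda>d. if d = 0 then 0 else 1 + of_int \<epsilon> * (-1) ^ d)"

text \<open>The coefficient at \<open>q\<close> is the part of the sum with largest summation index \<open>q\<close>
  (and \<open>q = 0\<close> for the empty sum).\<close>

definition M_fps :: "nat list \<Rightarrow> int list \<Rightarrow> rat fps" where
  "M_fps ks es = Abs_fps (\<lambda>q. M_N (Suc q) ks es - (if q = 0 then 0 else M_N q ks es))"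

lemma M_N_eq_sum_M_fps:
  assumes "0 < N"
  shows "M_N N ks es = (\<Sum>q<N. M_fps ks es $ q)"
  using assms
proof (induction N)
  case (Suc N)
  then show ?case by (cases "N = 0") (auto simp: M_fps_def)
qed simp

lemma M_fps_Nil [simp]: "M_fps [] es = 1"
  by (simp add: fps_eq_iff M_fps_def)

lemma M_fps_snoc_nth:
  assumes "length es = length ks"
  shows "M_fps (ks @ [k]) (es @ [\<epsilon>]) $ q =
    (if q = 0 then 0 else parity_weight \<epsilon> k q * M_N q ks es)"
proof (cases "q = 0")
  case False
  then have "{0<..<Suc q} = insert q {0<..<q}" by auto
  then show ?thesis using False by (simp add: M_fps_def M_N_snoc[OF assms])
qed (auto simp: M_fps_def M_N_snoc[OF assms] intro: sum.neutral)

text \<open>The factor 1 + \<epsilon> (-1)^q vanishes at the other parity, so the last sign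
  determines the parity of the largest index.\<close>

lemma M_fps_snoc_parity:
  assumes "length es = length ks" "\<epsilon> \<in> {1, -1}" "M_fps (ks @ [k]) (es @ [\<epsilon>]) $ q \<noteq> 0"
  shows "(-1) ^ q = (of_int \<epsilon> :: rat)"
  using assms(2,3) by (cases "even q") (auto simp: M_fps_snoc_nth[OF assms(1)] parity_weight_def split: if_splits)

text \<open>On the support of \<open>M_fps ks es\<close> the previous largest index i has (-1)^i =
  \<sigma>. Hence the factor 1 + \<sigma> \<delta> (-1)^q at the new index depends on the difference
  alone, as 1 + \<delta> (-1)^(q - i), and summing over i is multiplication by
  \<open>step_fps \<delta>\<close>.\<close>

lemma M_fps_snoc:
  assumes len: "length es = length ks" and "\<sigma> \<in> {1, -1}"
    and par: "\<And>q. M_fps ks es $ q \<noteq> 0 \<Longrightarrow> (-1) ^ q = (of_int \<sigma> :: rat)"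
  shows "M_fps (ks @ [k]) (es @ [\<sigma> * \<delta>]) = (fps_euler_int ^^ k) (step_fps \<delta> * M_fps ks es)"
proof (rule fps_ext)
  fix q
  have "(M_fps ks es * step_fps \<delta>) $ q =
      (\<Sum>i<q. M_fps ks es $ i * (1 + of_int \<delta> * (-1) ^ (q - i)))"
    by (simp add: fps_mult_nth step_fps_def atLeast0AtMost lessThan_Suc_atMost[symmetric])
  also have "\<dots> = (\<Sum>i<q. M_fps ks es $ i * (1 + of_int (\<sigma> * \<delta>) * (-1) ^ q))"
  proof (intro sum.cong refl)
    fix i assume i: "i \<in> {..<q}"
    show "M_fps ks es $ i * (1 + of_int \<delta> * (-1) ^ (q - i)) =
        M_fps ks es $ i * (1 + of_int (\<sigma> * \<delta>) * (-1) ^ q)"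
    proof (cases "M_fps ks es $ i = 0")
      case False
      have "(-1) ^ q = ((-1) ^ (q - i) * (-1) ^ i :: rat)"
        using i by (simp flip: power_add)
      then show ?thesis using par[OF False] assms(2) by auto
    qed simp
  qed
  finally show "M_fps (ks @ [k]) (es @ [\<sigma> * \<delta>]) $ q =
      (fps_euler_int ^^ k) (step_fps \<delta> * M_fps ks es) $ q"
    by (cases "q = 0") (simp_all add: M_fps_snoc_nth[OF len] fps_euler_int_funpow_nth
        parity_weight_def mult.commute[of "step_fps \<delta>"] M_N_eq_sum_M_fps sum_distrib_right[symmetric])
qed

lemma indices_1: "indices (Suc 0) (Suc j) = {[Suc j]}"
  by (auto simp: indices_def length_Suc_conv)

text \<open>Here \<open>j\<close> is the excess of weight over depth. A last entry
  \<open>Suc t\<close> uses up \<open>t\<close> of it, which matches the sum over \<open>t\<close>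
  in \<open>chain_fps\<close>.\<close>

lemma sum_indices_snoc:
  "(\<Sum>ks\<in>indices (Suc r) (Suc (r + j)). f ks) =
    (\<Sum>t\<le>j. \<Sum>ks\<in>indices r (r + (j - t)). f (ks @ [Suc t]))"
proof -
  \<comment> \<open>This bounds the excess \<open>t\<close> of the last entry by \<open>j\<close>,
    so that \<open>j - t\<close> is a true difference.\<close>
  have le: "length ks \<le> sum_list ks" if "\<forall>k\<in>set ks. 0 < k" for ks :: "nat list"
    using that by (induction ks) auto
  have "(\<Sum>ks\<in>indices (Suc r) (Suc (r + j)). f ks) =
      (\<Sum>(t, ks)\<in>Sigma {..j} (\<lambda>t. indices r (r + (j - t))). f (ks @ [Suc t]))"
  proof (rule sum.reindex_bij_witness[where j = "\<lambda>ks. (last ks - 1, butlast ks)"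
          and i = "\<lambda>(t, ks). ks @ [Suc t]"])
    fix ks assume ks: "ks \<in> indices (Suc r) (Suc (r + j))"
    then have "ks \<noteq> []" by (auto simp: indices_def)
    then obtain ks' k where "ks = ks' @ [k]" by (metis append_butlast_last_id)
    moreover from this ks obtain t where "k = Suc t" by (cases k) (auto simp: indices_def)
    ultimately have *: "ks = ks' @ [Suc t]" by simp
    show "(case (last ks - 1, butlast ks) of (t, ks) \<Rightarrow> ks @ [Suc t]) = ks" using * by simp
    show "(last ks - 1, butlast ks) \<in> Sigma {..j} (\<lambda>t. indices r (r + (j - t)))"
      using ks * le[of ks'] by (auto simp: indices_def)
    show "(case (last ks - 1, butlast ks) of (t, ks) \<Rightarrow> f (ks @ [Suc t])) = f ks" using * by simp
  next
    fix x assume "x \<in> Sigma {..j} (\<lambda>t. indices r (r + (j - t)))"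
    then show "(case x of (t, ks) \<Rightarrow> ks @ [Suc t]) \<in> indices (Suc r) (Suc (r + j))"
      by (auto simp: indices_def)
    show "(last (case x of (t, ks) \<Rightarrow> ks @ [Suc t]) - 1, butlast (case x of (t, ks) \<Rightarrow> ks @ [Suc t])) = x"
      by (cases x) simp
  qed
  also have "\<dots> = (\<Sum>t\<le>j. \<Sum>ks\<in>indices r (r + (j - t)). f (ks @ [Suc t]))"
    by (rule sum.Sigma[symmetric]) (auto simp: finite_indices)
  finally show ?thesis .
qed

text \<open>Relative to the parity \<sigma> reached by the prefix, the block prescribes sign
  \<delta> for its first difference and \<tau> for all later ones. An empty prefix is supported at 0
  and has \<sigma> = 1.\<close>

lemma sum_M_fps_block:
  assumes len: "length es = length ks" and sgn: "\<sigma> \<in> {1, -1}" "\<delta> \<in> {1, -1}" "\<tau> \<in> {1, -1}"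
    and par: "\<And>q. M_fps ks es $ q \<noteq> 0 \<Longrightarrow> (-1) ^ q = (of_int \<sigma> :: rat)"
  shows "(\<Sum>ls\<in>indices (Suc i) (Suc (i + j)). M_fps (ks @ ls) (es @ map (\<lambda>s. \<sigma> * \<delta> * \<tau> ^ s) [0..<Suc i])) =
    chain_fps (step_fps \<tau>) (step_fps \<delta> * M_fps ks es) i j"
proof (induction i arbitrary: j)
  case 0
  show ?case using M_fps_snoc[OF len sgn(1) par] by (simp add: indices_1)
next
  case (Suc i)
  let ?es = "\<lambda>i. es @ map (\<lambda>s. \<sigma> * \<delta> * \<tau> ^ s) [0..<i]"
  have step: "M_fps (ks @ ls @ [Suc t]) (?es (Suc (Suc i))) =
      (fps_euler_int ^^ Suc t) (step_fps \<tau> * M_fps (ks @ ls) (?es (Suc i)))"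
    if ls: "ls \<in> indices (Suc i) N" for ls t N
  proof -
    \<comment> \<open>The last entry of \<open>ls\<close> is exposed because the parity of the
      largest index so far is read off from it.\<close>
    have "length ls = Suc i" using ls by (simp add: indices_def)
    then obtain ls' l where l: "ls = ls' @ [l]" "length ls' = i"
      by (metis length_Suc_conv_rev)
    have pw: "\<tau> ^ i \<in> {1, -1}" using sgn(3) by (cases "even i") auto
    have e: "?es (Suc i) = (es @ map (\<lambda>s. \<sigma> * \<delta> * \<tau> ^ s) [0..<i]) @ [\<sigma> * \<delta> * \<tau> ^ i]"
      by simp
    have "M_fps ((ks @ ls) @ [Suc t]) (?es (Suc i) @ [(\<sigma> * \<delta> * \<tau> ^ i) * \<tau>]) =
        (fps_euler_int ^^ Suc t) (step_fps \<tau> * M_fps (ks @ ls) (?es (Suc i)))"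
    proof (rule M_fps_snoc)
      show "length (?es (Suc i)) = length (ks @ ls)" using len l by simp
      show s: "\<sigma> * \<delta> * \<tau> ^ i \<in> {1, -1}" using sgn pw by auto
      fix q assume "M_fps (ks @ ls) (?es (Suc i)) $ q \<noteq> 0"
      then have "M_fps ((ks @ ls') @ [l]) ((es @ map (\<lambda>s. \<sigma> * \<delta> * \<tau> ^ s) [0..<i]) @ [\<sigma> * \<delta> * \<tau> ^ i]) $ q \<noteq> 0"
        by (simp add: l)
      then show "(-1) ^ q = (of_int (\<sigma> * \<delta> * \<tau> ^ i) :: rat)"
        by (rule M_fps_snoc_parity[rotated 2]) (use s len l in auto)
    qed
    then show ?thesis by (simp add: mult.commute mult.left_commute)
  qed
  have "(\<Sum>ls\<in>indices (Suc (Suc i)) (Suc (Suc i + j)). M_fps (ks @ ls) (?es (Suc (Suc i)))) =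
    (\<Sum>t\<le>j. \<Sum>ls\<in>indices (Suc i) (Suc i + (j - t)). M_fps (ks @ ls @ [Suc t]) (?es (Suc (Suc i))))"
    by (rule sum_indices_snoc)
  also have "\<dots> = (\<Sum>t\<le>j. \<Sum>ls\<in>indices (Suc i) (Suc i + (j - t)).
      (fps_euler_int ^^ Suc t) (step_fps \<tau> * M_fps (ks @ ls) (?es (Suc i))))"
    by (intro sum.cong refl step)
  also have "\<dots> = (\<Sum>t\<le>j. (fps_euler_int ^^ Suc t) (step_fps \<tau> *
      (\<Sum>ls\<in>indices (Suc i) (Suc i + (j - t)). M_fps (ks @ ls) (?es (Suc i)))))"
    by (simp only: fps_euler_int_funpow_sum sum_distrib_left)
  also have "\<dots> = chain_fps (step_fps \<tau>) (step_fps \<delta> * M_fps ks es) (Suc i) j"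
    using Suc by (simp only: chain_fps.simps add_Suc)
  finally show ?case by simp
qed

section \<open>Rationals integral at p and their residues\<close>

text \<open>For prime \<open>p\<close> this is the localization of the integers at \<open>p\<close>.
  Fractions need not be reduced, so sums and products can be formed without cancelling.\<close>

definition plocal :: "nat \<Rightarrow> rat set" where
  "plocal p = {of_int u / of_int v | u v :: int. coprime v (int p) \<and> v \<noteq> 0}"

lemma plocalI: "coprime v (int p) \<Longrightarrow> v \<noteq> 0 \<Longrightarrow> of_int u / of_int v \<in> plocal p"
  unfolding plocal_def by blast

lemma plocalE:
  assumes "x \<in> plocal p"
  obtains u v where "coprime v (int p)" "v \<noteq> 0" "x = of_int u / of_int v"
    "[v * rat_mod x (int p) = u] (mod int p)"
  using assms rat_mod_fraction unfolding plocal_def by blast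

text \<open>Multiplying by the common denominator \<open>v * t\<close> turns the claim into a
  congruence of numerators; being coprime to \<open>p\<close>, it cancels again.\<close>

lemma plocal_add_rat_mod:
  assumes "x \<in> plocal p" "y \<in> plocal p"
  shows "x + y \<in> plocal p"
    and "[rat_mod (x + y) (int p) = rat_mod x (int p) + rat_mod y (int p)] (mod int p)"
proof -
  obtain u v where x: "coprime v (int p)" "v \<noteq> 0" "x = of_int u / of_int v"
    "[v * rat_mod x (int p) = u] (mod int p)" using plocalE[OF assms(1)] .
  obtain s t where y: "coprime t (int p)" "t \<noteq> 0" "y = of_int s / of_int t"
    "[t * rat_mod y (int p) = s] (mod int p)" using plocalE[OF assms(2)] .
  have xy: "x + y = of_int (u * t + s * v) / of_int (v * t)"
    using x(2,3) y(2,3) by (simp add: field_simps)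
  have c: "coprime (v * t) (int p)" "v * t \<noteq> 0" using x y by auto
  show "x + y \<in> plocal p" unfolding xy by (rule plocalI[OF c])
  have "[v * t * rat_mod (x + y) (int p) = u * t + s * v] (mod int p)"
    unfolding xy by (rule rat_mod_fraction[OF c])
  also have "[u * t + s * v = (v * rat_mod x (int p)) * t + (t * rat_mod y (int p)) * v] (mod int p)"
    by (intro cong_add cong_mult cong_refl x(4)[THEN cong_sym] y(4)[THEN cong_sym])
  also have "(v * rat_mod x (int p)) * t + (t * rat_mod y (int p)) * v =
      v * t * (rat_mod x (int p) + rat_mod y (int p))"
    by (simp add: algebra_simps)
  finally show "[rat_mod (x + y) (int p) = rat_mod x (int p) + rat_mod y (int p)] (mod int p)"
    using c(1) cong_mult_lcancel by blast
qed

lemma plocal_mult_rat_mod: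
  assumes "x \<in> plocal p" "y \<in> plocal p"
  shows "x * y \<in> plocal p"
    and "[rat_mod (x * y) (int p) = rat_mod x (int p) * rat_mod y (int p)] (mod int p)"
proof -
  obtain u v where x: "coprime v (int p)" "v \<noteq> 0" "x = of_int u / of_int v"
    "[v * rat_mod x (int p) = u] (mod int p)" using plocalE[OF assms(1)] .
  obtain s t where y: "coprime t (int p)" "t \<noteq> 0" "y = of_int s / of_int t"
    "[t * rat_mod y (int p) = s] (mod int p)" using plocalE[OF assms(2)] .
  have xy: "x * y = of_int (u * s) / of_int (v * t)"
    using x(3) y(3) by simp
  have c: "coprime (v * t) (int p)" "v * t \<noteq> 0" using x y by auto
  show "x * y \<in> plocal p" unfolding xy by (rule plocalI[OF c])
  have "[v * t * rat_mod (x * y) (int p) = u * s] (mod int p)"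
    unfolding xy by (rule rat_mod_fraction[OF c])
  also have "[u * s = (v * rat_mod x (int p)) * (t * rat_mod y (int p))] (mod int p)"
    by (intro cong_mult x(4)[THEN cong_sym] y(4)[THEN cong_sym])
  also have "(v * rat_mod x (int p)) * (t * rat_mod y (int p)) =
      v * t * (rat_mod x (int p) * rat_mod y (int p))"
    by (simp add: algebra_simps)
  finally show "[rat_mod (x * y) (int p) = rat_mod x (int p) * rat_mod y (int p)] (mod int p)"
    using c(1) cong_mult_lcancel by blast
qed

lemma plocal_of_int [simp]: "of_int u \<in> plocal p"
  unfolding plocal_def by (rule CollectI, rule exI[of _ u], rule exI[of _ 1]) simp

lemma rat_mod_of_int: "[rat_mod (of_int u) (int p) = u] (mod int p)"
  using rat_mod_fraction[of 1 "int p" u] by simp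

text \<open>Both claims are proved together, since additivity of the residue in the induction step
  needs the partial sum to be integral at \<open>p\<close>.\<close>

lemma plocal_sum_rat_mod:
  assumes "\<And>i. i \<in> S \<Longrightarrow> f i \<in> plocal p"
  shows "sum f S \<in> plocal p \<and> [rat_mod (sum f S) (int p) = (\<Sum>i\<in>S. rat_mod (f i) (int p))] (mod int p)"
  using assms
proof (induction S rule: infinite_finite_induct)
  case (insert x S)
  then have "f x \<in> plocal p" and S: "sum f S \<in> plocal p"
      "[rat_mod (sum f S) (int p) = (\<Sum>i\<in>S. rat_mod (f i) (int p))] (mod int p)"
    by auto
  from plocal_add_rat_mod[OF this(1,2)] cong_trans[OF _ cong_add[OF cong_refl S(2)]] show ?case
    using insert.hyps by simp
qed (use plocal_of_int[of 0 p] rat_mod_of_int[of 0 p] in auto)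

lemmas plocal_sum = plocal_sum_rat_mod[THEN conjunct1]
  and rat_mod_sum = plocal_sum_rat_mod[THEN conjunct2]

lemma parity_weight_fraction:
  "parity_weight \<epsilon> k q = of_int (1 + \<epsilon> * (-1) ^ q) / of_int (int q ^ k)"
  by (simp add: parity_weight_def)

lemma coprime_power_less_prime:
  assumes "prime p" "0 < q" "q < p"
  shows "coprime (int q ^ k) (int p)" "int q ^ k \<noteq> 0"
proof -
  have "coprime p q" using assms by (intro prime_imp_coprime) (auto dest: dvd_imp_le)
  then show "coprime (int q ^ k) (int p)" by (simp add: coprime_commute)
qed (use assms in auto)

lemma plocal_parity_weight:
  assumes "prime p" "0 < q" "q < p"
  shows "parity_weight \<epsilon> k q \<in> plocal p"
  unfolding parity_weight_fraction plocal_def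
  using coprime_power_less_prime[OF assms, of k] by blast

lemma plocal_M_N:
  assumes "prime p" "N \<le> p" "length es = length ks"
  shows "M_N N ks es \<in> plocal p"
  using assms(2,3)
proof (induction ks arbitrary: N es rule: rev_induct)
  case Nil
  then show ?case using plocal_of_int[of 1 p] by simp
next
  case (snoc k ks)
  then obtain es' \<epsilon> where es: "es = es' @ [\<epsilon>]" by (cases es rule: rev_cases) auto
  then have "length es' = length ks" using snoc.prems by simp
  then show ?case unfolding es M_N_snoc[OF \<open>length es' = length ks\<close>]
    using snoc.prems by (intro plocal_sum plocal_mult_rat_mod(1) plocal_parity_weight snoc.IH assms(1)) auto
qed

section \<open>Reflection modulo p and convolution sums\<close>

text \<open>Modulo \<open>p\<close> the denominator (p - r)^k is (-1)^k r^k, and for odd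
  \<open>p\<close> the numbers p - r and r have opposite parity, which negates the sign.\<close>

lemma rat_mod_parity_weight_reflect:
  assumes "prime p" "odd p" "0 < r" "r < p"
  shows "[rat_mod (parity_weight \<epsilon> k (p - r)) (int p) =
    (-1) ^ k * rat_mod (parity_weight (- \<epsilon>) k r) (int p)] (mod int p)"
proof -
  let ?u = "1 - \<epsilon> * (-1) ^ r"
  have "(-1) ^ (p - r) = (- ((-1) ^ r) :: int)"
    using assms(2,4) by (cases "even r") auto
  then have w: "parity_weight \<epsilon> k (p - r) = of_int ?u / of_int (int (p - r) ^ k)"
    unfolding parity_weight_fraction by simp
  have pr: "0 < p - r" "p - r < p" using assms(3,4) by auto
  have 1: "[int (p - r) ^ k * rat_mod (parity_weight \<epsilon> k (p - r)) (int p) = ?u] (mod int p)"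
    unfolding w by (intro rat_mod_fraction coprime_power_less_prime[OF assms(1) pr])
  have w': "parity_weight (- \<epsilon>) k r = of_int ?u / of_int (int r ^ k)"
    unfolding parity_weight_fraction by simp
  have 2: "[int r ^ k * rat_mod (parity_weight (- \<epsilon>) k r) (int p) = ?u] (mod int p)"
    unfolding w' by (intro rat_mod_fraction coprime_power_less_prime[OF assms(1,3,4)])
  have "[int (p - r) = - int r] (mod int p)"
    using assms(4) by (simp add: cong_iff_dvd_diff)
  then have "[int (p - r) ^ k = (- int r) ^ k] (mod int p)"
    by (rule cong_pow)
  then have 3: "[int (p - r) ^ k * rat_mod (parity_weight \<epsilon> k (p - r)) (int p) =
      (- int r) ^ k * rat_mod (parity_weight \<epsilon> k (p - r)) (int p)] (mod int p)"
    by (rule cong_mult) simp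
  \<comment> \<open>As (-1)^k is its own inverse, the sign of (-r)^k can be moved to the other
    side.\<close>
  have sq: "(-1) ^ k * (-1) ^ k = (1::int)" by (simp flip: power_mult_distrib)
  have "[int r ^ k * rat_mod (parity_weight \<epsilon> k (p - r)) (int p) =
      (-1) ^ k * ((- int r) ^ k * rat_mod (parity_weight \<epsilon> k (p - r)) (int p))] (mod int p)"
    by (subst power_minus) (simp add: sq mult.assoc[symmetric])
  also have "[(-1) ^ k * ((- int r) ^ k * rat_mod (parity_weight \<epsilon> k (p - r)) (int p)) =
      (-1) ^ k * (int r ^ k * rat_mod (parity_weight (- \<epsilon>) k r) (int p))] (mod int p)"
    by (intro cong_mult cong_refl cong_trans[OF cong_sym[OF 3] cong_trans[OF 1 cong_sym[OF 2]]])
  also have "(-1) ^ k * (int r ^ k * rat_mod (parity_weight (- \<epsilon>) k r) (int p)) =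
      int r ^ k * ((-1) ^ k * rat_mod (parity_weight (- \<epsilon>) k r) (int p))"
    by simp
  finally show ?thesis
    using coprime_power_less_prime(1)[OF assms(1,3,4)] cong_mult_lcancel by blast
qed

text \<open>Sums over pairs of chains whose largest indices q and q' satisfy q + q' < N, an empty
  chain counting as largest index 0.\<close>

definition M_conv :: "nat \<Rightarrow> nat list \<Rightarrow> int list \<Rightarrow> nat list \<Rightarrow> int list \<Rightarrow> rat" where
  "M_conv N ks es ls es' = (\<Sum>q<N. M_fps ks es $ q * M_N (N - q) ls es')"

lemma plocal_M_conv:
  assumes "prime p" "length es = length ks" "length es' = length ls"
  shows "M_conv p ks es ls es' \<in> plocal p"
proof -
  \<comment> \<open>Coefficients of \<open>M_fps\<close> are differences of truncated sums, so
    closure under subtraction is needed.\<close>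
  have diff: "x - y \<in> plocal p" if "x \<in> plocal p" "y \<in> plocal p" for x y
  proof -
    have "x - y = x + of_int (-1) * y" by simp
    then show ?thesis
      by (simp only: plocal_add_rat_mod(1) plocal_mult_rat_mod(1) plocal_of_int that)
  qed
  have "M_fps ks es $ q \<in> plocal p" if "q < p" for q
  proof (cases "q = 0")
    case True
    then show ?thesis
      using that plocal_M_N[OF assms(1) _ assms(2), of "Suc 0"] by (simp add: M_fps_def)
  next
    case False
    then have "M_fps ks es $ q = M_N (Suc q) ks es - M_N q ks es"
      by (simp add: M_fps_def)
    moreover have "\<dots> \<in> plocal p"
      by (rule diff; rule plocal_M_N[OF assms(1) _ assms(2)]) (use that in auto)
    ultimately show ?thesis by simp
  qed
  then show ?thesis
    unfolding M_conv_def by (intro plocal_sum plocal_mult_rat_mod(1) plocal_M_N assms) auto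
qed

lemma M_conv_Nil_right:
  assumes "0 < N"
  shows "M_conv N ks es [] es' = M_N N ks es"
  using assms by (simp add: M_conv_def M_N_eq_sum_M_fps)

text \<open>A coefficient of the product collects the pairs with q + q' fixed; adding up those below
  \<open>N\<close> fills the triangle q + q' < N.\<close>

lemma sum_fps_mult_M_fps:
  "(\<Sum>q<N. (M_fps ks es * M_fps ls es') $ q) = M_conv N ks es ls es'"
proof -
  have "(\<Sum>q<N. (M_fps ks es * M_fps ls es') $ q) =
      (\<Sum>(q, i)\<in>Sigma {..<N} (\<lambda>q. {..q}). M_fps ks es $ i * M_fps ls es' $ (q - i))"
    by (simp add: fps_mult_nth atLeast0AtMost sum.Sigma)
  also have "\<dots> = (\<Sum>(i, j)\<in>Sigma {..<N} (\<lambda>i. {..<N - i}). M_fps ks es $ i * M_fps ls es' $ j)"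
    by (rule sum.reindex_bij_witness[where j = "\<lambda>(q, i). (i, q - i)" and i = "\<lambda>(i, j). (i + j, i)"]) auto
  also have "\<dots> = M_conv N ks es ls es'"
    by (simp add: M_conv_def sum.Sigma[symmetric] M_N_eq_sum_M_fps sum_distrib_left)
  finally show ?thesis .
qed

text \<open>The largest index of the second chain is written as N - r. The first chain then lies
  below \<open>r\<close>, and the rest of the second below N - r.\<close>

lemma M_conv_snoc_right:
  assumes "length es' = length ls"
  shows "M_conv N ks es (ls @ [k]) (es' @ [\<epsilon>]) =
    (\<Sum>r\<in>{0<..<N}. parity_weight \<epsilon> k (N - r) * (M_N r ks es * M_N (N - r) ls es'))"
proof -
  have "M_conv N ks es (ls @ [k]) (es' @ [\<epsilon>]) =
      (\<Sum>(q, q')\<in>Sigma {..<N} (\<lambda>q. {0<..<N - q}).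
        M_fps ks es $ q * (parity_weight \<epsilon> k q' * M_N q' ls es'))"
    by (simp add: M_conv_def M_N_snoc[OF assms] sum.Sigma sum_distrib_left)
  also have "\<dots> = (\<Sum>(r, q)\<in>Sigma {0<..<N} (\<lambda>r. {..<r}).
        M_fps ks es $ q * (parity_weight \<epsilon> k (N - r) * M_N (N - r) ls es'))"
    by (rule sum.reindex_bij_witness[where j = "\<lambda>(q, q'). (N - q', q)" and i = "\<lambda>(r, q). (q, N - r)"]) auto
  also have "\<dots> = (\<Sum>r\<in>{0<..<N}. parity_weight \<epsilon> k (N - r) * (M_N r ks es * M_N (N - r) ls es'))"
    unfolding sum.Sigma[OF finite_greaterThanLessThan ballI[OF finite_lessThan], symmetric]
    by (intro sum.cong refl)
      (simp add: M_N_eq_sum_M_fps[of _ ks es] mult_ac flip: sum_distrib_right sum_distrib_left)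
  finally show ?thesis .
qed

text \<open>With \<open>r\<close> now the largest index of the first chain, the cofactor of the
  weight is the same as for an entry appended on the right; only the weight is taken at
  \<open>r\<close> instead of N - r.\<close>

lemma M_conv_snoc_left:
  assumes "length es = length ks"
  shows "M_conv N (ks @ [k]) (es @ [\<epsilon>]) ls es' =
    (\<Sum>r\<in>{0<..<N}. parity_weight \<epsilon> k r * (M_N r ks es * M_N (N - r) ls es'))"
proof -
  have "M_conv N (ks @ [k]) (es @ [\<epsilon>]) ls es' =
      (\<Sum>q\<in>{0<..<N}. M_fps (ks @ [k]) (es @ [\<epsilon>]) $ q * M_N (N - q) ls es')"
    unfolding M_conv_def by (rule sum.mono_neutral_right) (auto simp: M_fps_snoc_nth[OF assms])
  then show ?thesis by (simp add: M_fps_snoc_nth[OF assms] mult.assoc)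
qed

text \<open>Since the cofactors agree, reflecting the weight moves the last entry of the second
  index to the end of the first, at the cost of (-1)^k and a negated sign.\<close>

lemma rat_mod_M_conv_reflect:
  assumes "prime p" "odd p" "length es = length ks" "length es' = length ls"
  shows "[rat_mod (M_conv p ks es (ls @ [k]) (es' @ [\<epsilon>])) (int p) =
    (-1) ^ k * rat_mod (M_conv p (ks @ [k]) (es @ [- \<epsilon>]) ls es') (int p)] (mod int p)"
proof -
  let ?c = "\<lambda>r. M_N r ks es * M_N (p - r) ls es'"
  have c: "?c r \<in> plocal p" if "r \<in> {0<..<p}" for r
    using that by (intro plocal_mult_rat_mod(1) plocal_M_N assms) auto
  have w: "parity_weight \<epsilon> k r \<in> plocal p" if "r \<in> {0<..<p}" for r \<epsilon>
    using that by (intro plocal_parity_weight assms) auto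
  have w': "parity_weight \<epsilon> k (p - r) \<in> plocal p" if "r \<in> {0<..<p}" for r
    using that by (intro plocal_parity_weight assms) auto
  have "[rat_mod (M_conv p ks es (ls @ [k]) (es' @ [\<epsilon>])) (int p) =
      (\<Sum>r\<in>{0<..<p}. rat_mod (parity_weight \<epsilon> k (p - r) * ?c r) (int p))] (mod int p)"
    unfolding M_conv_snoc_right[OF assms(4)] by (intro rat_mod_sum plocal_mult_rat_mod(1)[OF w' c])
  also have "[(\<Sum>r\<in>{0<..<p}. rat_mod (parity_weight \<epsilon> k (p - r) * ?c r) (int p)) =
      (\<Sum>r\<in>{0<..<p}. (-1) ^ k * rat_mod (parity_weight (- \<epsilon>) k r * ?c r) (int p))] (mod int p)"
  proof (rule cong_sum)
    fix r assume r: "r \<in> {0<..<p}"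
    have "[rat_mod (parity_weight \<epsilon> k (p - r) * ?c r) (int p) =
        rat_mod (parity_weight \<epsilon> k (p - r)) (int p) * rat_mod (?c r) (int p)] (mod int p)"
      by (rule plocal_mult_rat_mod(2)[OF w'[OF r] c[OF r]])
    also have "[rat_mod (parity_weight \<epsilon> k (p - r)) (int p) * rat_mod (?c r) (int p) =
        ((-1) ^ k * rat_mod (parity_weight (- \<epsilon>) k r) (int p)) * rat_mod (?c r) (int p)] (mod int p)"
      using r by (intro cong_mult cong_refl rat_mod_parity_weight_reflect assms) auto
    also have "[((-1) ^ k * rat_mod (parity_weight (- \<epsilon>) k r) (int p)) * rat_mod (?c r) (int p) =
        (-1) ^ k * rat_mod (parity_weight (- \<epsilon>) k r * ?c r) (int p)] (mod int p)"
      unfolding mult.assoc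
      by (intro cong_mult cong_refl cong_sym[OF plocal_mult_rat_mod(2)[OF w[OF r] c[OF r]]])
    finally show "[rat_mod (parity_weight \<epsilon> k (p - r) * ?c r) (int p) =
        (-1) ^ k * rat_mod (parity_weight (- \<epsilon>) k r * ?c r) (int p)] (mod int p)" .
  qed
  also have "[(\<Sum>r\<in>{0<..<p}. (-1) ^ k * rat_mod (parity_weight (- \<epsilon>) k r * ?c r) (int p)) =
      (-1) ^ k * rat_mod (M_conv p (ks @ [k]) (es @ [- \<epsilon>]) ls es') (int p)] (mod int p)"
    unfolding M_conv_snoc_left[OF assms(3)] sum_distrib_left[symmetric]
    by (intro cong_mult cong_refl cong_sym[OF rat_mod_sum] plocal_mult_rat_mod(1)[OF w c])
  finally show ?thesis .
qed

text \<open>Entries are moved one at a time from the end of \<open>ls\<close>, hence they arrive in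
  reversed order; their factors multiply to (-1) to the weight of \<open>ls\<close>.\<close>

lemma rat_mod_M_conv:
  assumes "prime p" "odd p" "length es = length ks" "length es' = length ls"
  shows "[rat_mod (M_conv p ks es ls es') (int p) =
    (-1) ^ sum_list ls * rat_mod (M_N p (ks @ rev ls) (es @ map uminus (rev es'))) (int p)] (mod int p)"
  using assms(3,4)
proof (induction ls arbitrary: ks es es' rule: rev_induct)
  case Nil
  then show ?case using assms(1) by (simp add: M_conv_Nil_right prime_gt_0_nat)
next
  case (snoc k ls)
  then obtain es'' \<epsilon> where es': "es' = es'' @ [\<epsilon>]" by (cases es' rule: rev_cases) auto
  then have len: "length es'' = length ls" using snoc.prems by simp
  have "[rat_mod (M_conv p ks es (ls @ [k]) es') (int p) =
      (-1) ^ k * rat_mod (M_conv p (ks @ [k]) (es @ [- \<epsilon>]) ls es'') (int p)] (mod int p)"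
    unfolding es' by (rule rat_mod_M_conv_reflect[OF assms(1,2) snoc.prems(1) len])
  also have "[(-1) ^ k * rat_mod (M_conv p (ks @ [k]) (es @ [- \<epsilon>]) ls es'') (int p) =
      (-1) ^ k * ((-1) ^ sum_list ls * rat_mod (M_N p ((ks @ [k]) @ rev ls)
        ((es @ [- \<epsilon>]) @ map uminus (rev es''))) (int p))] (mod int p)"
    using snoc.prems len by (intro cong_mult cong_refl snoc.IH) auto
  finally show ?case by (simp add: es' power_add mult_ac)
qed

section \<open>Computing in \<A> with representatives\<close>

text \<open>Finitely many primes do not affect a class, so the prime 2, where reflection preserves
  parity, may be left out.\<close>

lemma class_A_eqI:
  assumes "\<And>p. prime p \<Longrightarrow> odd p \<Longrightarrow> [x p = y p] (mod int p)"
  shows "class_A x = class_A y"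
proof -
  have "{p. prime p \<and> \<not> [x p = y p] (mod int p)} \<subseteq> {2}"
    using assms primes_dvd_imp_eq[OF two_is_prime_nat] by auto
  then show ?thesis
    unfolding class_A_eq_iff by (rule finite_subset) simp
qed

lemma class_A_add: "class_A x \<oplus>\<^bsub>\<A>\<^esub> class_A y = class_A (\<lambda>p. x p + y p)"
proof -
  interpret ideal sum_Zp prod_Zp by (rule ideal_sum_Zp)
  have "class_A x \<oplus>\<^bsub>\<A>\<^esub> class_A y = sum_Zp +>\<^bsub>prod_Zp\<^esub>
      ((\<lambda>p\<in>primes. x p mod int p) \<oplus>\<^bsub>prod_Zp\<^esub> (\<lambda>p\<in>primes. y p mod int p))"
    unfolding class_A_def ringA_def FactRing_def
    using a_rcos_sum[OF reduce_in_prod_Zp reduce_in_prod_Zp] by simp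
  also have "(\<lambda>p\<in>primes. x p mod int p) \<oplus>\<^bsub>prod_Zp\<^esub> (\<lambda>p\<in>primes. y p mod int p) =
      (\<lambda>p\<in>primes. (x p + y p) mod int p)"
    by (auto simp: prod_Zp_simps(2) fun_eq_iff mod_simps)
  finally show ?thesis by (simp only: class_A_def)
qed

text \<open>The class is its own double, and in a group only zero is.\<close>

lemma class_A_0: "class_A (\<lambda>p. 0) = \<zero>\<^bsub>\<A>\<^esub>"
proof -
  interpret cring \<A> by (rule cring_ringA)
  have "class_A (\<lambda>p. 0) \<oplus>\<^bsub>\<A>\<^esub> class_A (\<lambda>p. 0) = class_A (\<lambda>p. 0)"
    by (simp add: class_A_add)
  then show ?thesis
    using add.l_cancel_one[OF class_A_closed class_A_closed] by simp
qed

lemma class_A_uminus: "\<ominus>\<^bsub>\<A>\<^esub> class_A x = class_A (\<lambda>p. - x p)"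
proof -
  interpret cring \<A> by (rule cring_ringA)
  show ?thesis
    by (rule minus_equality) (simp_all add: class_A_add class_A_closed class_A_0)
qed

lemma class_A_finsum:
  assumes "finite S"
  shows "(\<Oplus>\<^bsub>\<A>\<^esub>i\<in>S. class_A (f i)) = class_A (\<lambda>p. \<Sum>i\<in>S. f i p)"
proof -
  interpret cring \<A> by (rule cring_ringA)
  show ?thesis using assms
    by induction (simp_all add: class_A_closed class_A_0 class_A_add)
qed

lemma class_A_nat_add_pow: "[(k::nat)] \<cdot>\<^bsub>\<A>\<^esub> class_A x = class_A (\<lambda>p. int k * x p)"
proof -
  interpret cring \<A> by (rule cring_ringA)
  show ?thesis
    by (induction k) (simp_all add: class_A_0 class_A_add algebra_simps)
qed

lemma class_A_int_add_pow: "[(k::int)] \<cdot>\<^bsub>\<A>\<^esub> class_A x = class_A (\<lambda>p. k * x p)"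
proof -
  interpret cring \<A> by (rule cring_ringA)
  show ?thesis
  proof (cases "k \<ge> 0")
    case True
    then show ?thesis by (simp add: add_pow_int_ge class_A_nat_add_pow)
  next
    case False
    then show ?thesis by (simp add: add_pow_int_lt class_A_nat_add_pow class_A_uminus)
  qed
qed

section \<open>The rational identity and its reduction\<close>

text \<open>The block formula is applied twice: first to the empty prefix, then to
  \<open>ks\<close>, whose largest index has the parity of its last sign. Relative to that sign, the
  second block opens with a difference of sign \<open>\<delta>\<^sub>2\<close>; linearity of
  \<open>chain_fps\<close> in its initial series collects the sum over \<open>ks\<close>.\<close>

lemma sum_two_blocks:
  assumes sgn: "\<delta>\<^sub>1 \<in> {1, -1}" "\<delta>\<^sub>2 \<in> {1, -1}" "\<tau> \<in> {1, -1}" and "0 < p"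
  shows "(\<Sum>ks\<in>indices (i' + 1) (i' + j' + 1). \<Sum>ls\<in>indices (i + 1) (i + j + 1).
      M_N p (ks @ ls) (map (\<lambda>s. \<delta>\<^sub>1 * \<tau> ^ s) [0..<i' + 1] @
        map (\<lambda>s. \<delta>\<^sub>1 * \<delta>\<^sub>2 * \<tau> ^ s) [i'..<i' + i + 1])) =
    (\<Sum>q<p. chain_fps (step_fps \<tau>) (step_fps \<delta>\<^sub>2 *
      chain_fps (step_fps \<tau>) (step_fps \<delta>\<^sub>1) i' j') i j $ q)"
proof -
  let ?es = "map (\<lambda>s. \<delta>\<^sub>1 * \<tau> ^ s) [0..<Suc i']"
  let ?\<sigma> = "\<delta>\<^sub>1 * \<tau> ^ i'"
  have \<sigma>: "?\<sigma> \<in> {1, -1}" using sgn by (cases "even i'") auto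
  have shift: "map (\<lambda>s. \<delta>\<^sub>1 * \<delta>\<^sub>2 * \<tau> ^ s) [i'..<i' + i + 1] = map (\<lambda>s. ?\<sigma> * \<delta>\<^sub>2 * \<tau> ^ s) [0..<Suc i]"
    by (rule nth_equalityI) (auto simp: power_add simp del: upt_Suc)
  have block: "(\<Sum>ls\<in>indices (Suc i) (Suc (i + j)).
      M_fps (ks @ ls) (?es @ map (\<lambda>s. ?\<sigma> * \<delta>\<^sub>2 * \<tau> ^ s) [0..<Suc i])) =
      chain_fps (step_fps \<tau>) (step_fps \<delta>\<^sub>2 * M_fps ks ?es) i j"
    if ks: "ks \<in> indices (Suc i') N" for ks N
  proof (rule sum_M_fps_block[OF _ \<sigma> sgn(2,3)])
    have len: "length ks = Suc i'" using ks by (simp add: indices_def)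
    then show "length ?es = length ks" by simp
    from len obtain ks' k where k: "ks = ks' @ [k]" "length ks' = i'"
      by (metis length_Suc_conv_rev)
    fix q assume "M_fps ks ?es $ q \<noteq> 0"
    then have "M_fps (ks' @ [k]) (map (\<lambda>s. \<delta>\<^sub>1 * \<tau> ^ s) [0..<i'] @ [?\<sigma>]) $ q \<noteq> 0"
      by (simp add: k)
    then show "(-1) ^ q = (of_int ?\<sigma> :: rat)"
      by (rule M_fps_snoc_parity[rotated 2]) (use \<sigma> k in auto)
  qed
  have first: "(\<Sum>ks\<in>indices (Suc i') (Suc (i' + j')). M_fps ks ?es) =
      chain_fps (step_fps \<tau>) (step_fps \<delta>\<^sub>1) i' j'"
    using sum_M_fps_block[of "[]" "[]" 1 \<delta>\<^sub>1 \<tau> i' j'] sgn by (simp split: if_splits)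
  have "(\<Sum>ks\<in>indices (Suc i') (Suc (i' + j')). \<Sum>ls\<in>indices (Suc i) (Suc (i + j)).
      M_fps (ks @ ls) (?es @ map (\<lambda>s. ?\<sigma> * \<delta>\<^sub>2 * \<tau> ^ s) [0..<Suc i])) =
      (\<Sum>ks\<in>indices (Suc i') (Suc (i' + j')). chain_fps (step_fps \<tau>) (step_fps \<delta>\<^sub>2 * M_fps ks ?es) i j)"
    by (intro sum.cong refl block)
  also have "\<dots> = chain_fps (step_fps \<tau>) (step_fps \<delta>\<^sub>2 *
      chain_fps (step_fps \<tau>) (step_fps \<delta>\<^sub>1) i' j') i j"
    unfolding first[symmetric] sum_distrib_left by (rule chain_fps_sum[symmetric])
  finally show ?thesis
    unfolding shift M_N_eq_sum_M_fps[OF \<open>0 < p\<close>] sum.swap[of _ "{..<p}"]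
    by (simp only: fps_sum_nth[symmetric] Suc_eq_plus1 add.assoc)
qed

lemma indices_rev: "bij_betw rev (indices r N) (indices r N)"
  by (rule bij_betw_byWitness[where f' = rev]) (auto simp: indices_def)

lemma sum_M_conv:
  assumes sgn: "\<delta>\<^sub>1 \<in> {1, -1}" "\<delta>\<^sub>2 \<in> {1, -1}" "\<tau> \<in> {1, -1}"
  shows "(\<Sum>ks\<in>indices (i' + 1) (i' + j' + 1). \<Sum>ls\<in>indices (i + 1) (i + j + 1).
      M_conv p ks (map (\<lambda>s. \<delta>\<^sub>1 * \<tau> ^ s) [0..<i' + 1]) ls (map (\<lambda>s. \<delta>\<^sub>2 * \<tau> ^ s) [0..<i + 1])) =
    (\<Sum>q<p. (chain_fps (step_fps \<tau>) (step_fps \<delta>\<^sub>1) i' j' *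
      chain_fps (step_fps \<tau>) (step_fps \<delta>\<^sub>2) i j) $ q)"
proof -
  have block: "chain_fps (step_fps \<tau>) (step_fps \<delta>) i j =
      (\<Sum>ks\<in>indices (i + 1) (i + j + 1). M_fps ks (map (\<lambda>s. \<delta> * \<tau> ^ s) [0..<i + 1]))"
    if "\<delta> \<in> {1, -1}" for \<delta> i j
    using sum_M_fps_block[of "[]" "[]" 1 \<delta> \<tau> i j] that sgn by (simp split: if_splits)
  show ?thesis
    unfolding block[OF sgn(1)] block[OF sgn(2)] sum_product fps_sum_nth sum_fps_mult_M_fps[symmetric]
    by (simp only: sum.swap[of _ "{..<p}"])
qed

text \<open>Partial sums of coefficients in the product formula \<open>chain_fps_shuffle\<close>,
  with m' = a - m and n' = b - n. The identity is exact over the rationals and holds for every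
  positive \<open>p\<close>.\<close>

lemma mixed_value_identity:
  assumes sgn: "\<delta>\<^sub>1 \<in> {1, -1}" "\<delta>\<^sub>2 \<in> {1, -1}" "\<tau> \<in> {1, -1}" and p: "0 < p"
    and mn: "m \<le> a" "n \<le> b"
  shows "(\<Sum>i\<in>{0..a}. \<Sum>j\<in>{0..b}. of_nat ((i choose m) * (j choose n)) *
        (\<Sum>ks\<in>indices (a - i + 1) (a + b - i - j + 1). \<Sum>ls\<in>indices (i + 1) (i + j + 1).
          M_N p (ks @ ls) (map (\<lambda>s. \<delta>\<^sub>1 * \<tau> ^ s) [0..<a - i + 1] @
            map (\<lambda>s. \<delta>\<^sub>1 * \<delta>\<^sub>2 * \<tau> ^ s) [a - i..<a + 1]))) +
      (\<Sum>i\<in>{0..a}. \<Sum>j\<in>{0..b}. of_nat ((i choose (a - m)) * (j choose (b - n))) *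
        (\<Sum>ks\<in>indices (a - i + 1) (a + b - i - j + 1). \<Sum>ls\<in>indices (i + 1) (i + j + 1).
          M_N p (ks @ ls) (map (\<lambda>s. \<delta>\<^sub>2 * \<tau> ^ s) [0..<a - i + 1] @
            map (\<lambda>s. \<delta>\<^sub>1 * \<delta>\<^sub>2 * \<tau> ^ s) [a - i..<a + 1]))) =
      (\<Sum>ks\<in>indices (a - m + 1) (a + b - m - n + 1). \<Sum>ls\<in>indices (m + 1) (m + n + 1).
        M_conv p ks (map (\<lambda>s. \<delta>\<^sub>1 * \<tau> ^ s) [0..<a - m + 1]) ls (map (\<lambda>s. \<delta>\<^sub>2 * \<tau> ^ s) [0..<m + 1]))"
proof -
  let ?e = "step_fps \<tau>"
  \<comment> \<open>The signs and exponents are left general because both sums on the left are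
    instances.\<close>
  have L: "(\<Sum>i\<in>{0..m' + m}. \<Sum>j\<in>{0..n' + n}. of_nat ((i choose m) * (j choose n)) *
        (\<Sum>ks\<in>indices (m' + m - i + 1) (m' + m + (n' + n) - i - j + 1). \<Sum>ls\<in>indices (i + 1) (i + j + 1).
          M_N p (ks @ ls) (map (\<lambda>s. \<delta>\<^sub>1 * \<tau> ^ s) [0..<m' + m - i + 1] @
            map (\<lambda>s. \<delta>\<^sub>1 * \<delta>\<^sub>2 * \<tau> ^ s) [m' + m - i..<m' + m + 1]))) =
      (\<Sum>q<p. chain_sum ?e (\<lambda>i j. step_fps \<delta>\<^sub>2 * chain_fps ?e (step_fps \<delta>\<^sub>1) i j) m' m n' n $ q)"
    if sgn: "\<delta>\<^sub>1 \<in> {1, -1}" "\<delta>\<^sub>2 \<in> {1, -1}" for \<delta>\<^sub>1 \<delta>\<^sub>2 m' m n' n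
  proof -
    have "(\<Sum>ks\<in>indices (m' + m - i + 1) (m' + m + (n' + n) - i - j + 1). \<Sum>ls\<in>indices (i + 1) (i + j + 1).
          M_N p (ks @ ls) (map (\<lambda>s. \<delta>\<^sub>1 * \<tau> ^ s) [0..<m' + m - i + 1] @
            map (\<lambda>s. \<delta>\<^sub>1 * \<delta>\<^sub>2 * \<tau> ^ s) [m' + m - i..<m' + m + 1])) =
        (\<Sum>q<p. chain_fps ?e (step_fps \<delta>\<^sub>2 *
          chain_fps ?e (step_fps \<delta>\<^sub>1) (m' + m - i) (n' + n - j)) i j $ q)"
      if "i \<le> m' + m" "j \<le> n' + n" for i j
    proof -
      \<comment> \<open>Writing the totals as sums turns all truncated subtractions into plain
        cancellations.\<close>
      obtain i' j' where ij: "m' + m = i' + i" "n' + n = j' + j"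
        using \<open>i \<le> m' + m\<close> \<open>j \<le> n' + n\<close> by (metis add.commute le_iff_add)
      have sub: "i' + i - i = i'" "j' + j - j = j'" "i' + i + (j' + j) - i - j + 1 = i' + j' + 1"
        by auto
      show ?thesis
        unfolding ij sub by (rule sum_two_blocks[OF sgn assms(3) p])
    qed
    then have "(\<Sum>i\<in>{0..m' + m}. \<Sum>j\<in>{0..n' + n}. of_nat ((i choose m) * (j choose n)) *
        (\<Sum>ks\<in>indices (m' + m - i + 1) (m' + m + (n' + n) - i - j + 1). \<Sum>ls\<in>indices (i + 1) (i + j + 1).
          M_N p (ks @ ls) (map (\<lambda>s. \<delta>\<^sub>1 * \<tau> ^ s) [0..<m' + m - i + 1] @
            map (\<lambda>s. \<delta>\<^sub>1 * \<delta>\<^sub>2 * \<tau> ^ s) [m' + m - i..<m' + m + 1]))) =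
      (\<Sum>i\<in>{0..m' + m}. \<Sum>j\<in>{0..n' + n}. of_nat ((i choose m) * (j choose n)) *
        (\<Sum>q<p. chain_fps ?e (step_fps \<delta>\<^sub>2 *
          chain_fps ?e (step_fps \<delta>\<^sub>1) (m' + m - i) (n' + n - j)) i j $ q))"
      by (intro sum.cong refl arg_cong2[where f = "(*)"]) auto
    also have "\<dots> = (\<Sum>i\<in>{0..m' + m}. \<Sum>j\<in>{0..n' + n}. \<Sum>q<p.
        (of_nat (i choose m) * (of_nat (j choose n) * chain_fps ?e (step_fps \<delta>\<^sub>2 *
          chain_fps ?e (step_fps \<delta>\<^sub>1) (m' + m - i) (n' + n - j)) i j)) $ q)"
      by (simp only: sum_distrib_left fps_mult_of_nat_nth of_nat_mult mult.assoc)
    also have "\<dots> = (\<Sum>q<p. chain_sum ?e (\<lambda>i j. step_fps \<delta>\<^sub>2 * chain_fps ?e (step_fps \<delta>\<^sub>1) i j) m' m n' n $ q)"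
      by (simp only: sum.swap[of _ "{..<p}"] chain_sum_def fps_sum_nth atLeast0AtMost)
    finally show ?thesis .
  qed
  define m' n' where "m' = a - m" and "n' = b - n"
  have ab: "a = m' + m" "b = n' + n" using mn by (auto simp: m'_def n'_def)
  have z: "step_fps \<epsilon> $ 0 = 0" for \<epsilon> by (simp add: step_fps_def)
  \<comment> \<open>The second sum exchanges the two signs and replaces m, n by a - m, b - n;
    commutativity restores the common totals.\<close>
  note L2 = L[OF sgn(2,1), where m' = m and m = m' and n' = n and n = n', unfolded add.commute[of m m'] add.commute[of n n']
      mult.commute[of \<delta>\<^sub>2 \<delta>\<^sub>1]]
  have r: "m' + m - m = m'" "n' + n - n = n'" "m' + m + (n' + n) - m - n + 1 = m' + n' + 1" by auto
  show ?thesis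
    unfolding ab r L[OF sgn(1,2)] L2 sum_M_conv[OF sgn] chain_fps_shuffle[OF z z z, symmetric]
    by (simp add: sum.distrib)
qed

theorem theorem1p1:
  fixes a b m n :: nat and \<delta>\<^sub>1 \<delta>\<^sub>2 \<tau> :: int
  assumes "\<delta>\<^sub>1 \<in> {1, -1}" and "\<delta>\<^sub>2 \<in> {1, -1}" and "\<tau> \<in> {1, -1}"
    and "0 \<le> m" and "m \<le> a" and "0 \<le> n" and "n \<le> b"
  shows
    "(\<Oplus>\<^bsub>\<A>\<^esub>i\<in>{0..a}. \<Oplus>\<^bsub>\<A>\<^esub>j\<in>{0..b}. [((i choose m) * (j choose n))] \<cdot>\<^bsub>\<A>\<^esub>
        (\<Oplus>\<^bsub>\<A>\<^esub>ks\<in>indices (a - i + 1) (a + b - i - j + 1).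
         \<Oplus>\<^bsub>\<A>\<^esub>ls\<in>indices (i + 1) (i + j + 1).
           M\<^sub>\<A> (ks @ ls)
             (map (\<lambda>s. \<delta>\<^sub>1 * \<tau> ^ s) [0..<a - i + 1] @
              map (\<lambda>s. \<delta>\<^sub>1 * \<delta>\<^sub>2 * \<tau> ^ s) [a - i..<a + 1])))
     \<oplus>\<^bsub>\<A>\<^esub>
     (\<Oplus>\<^bsub>\<A>\<^esub>i\<in>{0..a}. \<Oplus>\<^bsub>\<A>\<^esub>j\<in>{0..b}. [((i choose (a - m)) * (j choose (b - n)))] \<cdot>\<^bsub>\<A>\<^esub>
        (\<Oplus>\<^bsub>\<A>\<^esub>ks\<in>indices (a - i + 1) (a + b - i - j + 1).
         \<Oplus>\<^bsub>\<A>\<^esub>ls\<in>indices (i + 1) (i + j + 1).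
           M\<^sub>\<A> (ks @ ls)
             (map (\<lambda>s. \<delta>\<^sub>2 * \<tau> ^ s) [0..<a - i + 1] @
              map (\<lambda>s. \<delta>\<^sub>1 * \<delta>\<^sub>2 * \<tau> ^ s) [a - i..<a + 1])))
     =
     (\<Oplus>\<^bsub>\<A>\<^esub>ks\<in>indices (a - m + 1) (a + b - m - n + 1).
         \<Oplus>\<^bsub>\<A>\<^esub>ls\<in>indices (m + 1) (m + n + 1).
        [((-1) ^ (m + n + 1) :: int)] \<cdot>\<^bsub>\<A>\<^esub>
          (M\<^sub>\<A> (ks @ ls)
            (map (\<lambda>s. \<delta>\<^sub>1 * \<tau> ^ s) [0..<a - m + 1] @
             map (\<lambda>s. - \<delta>\<^sub>2 * \<tau> ^ s) (rev [0..<m + 1]))))"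
proof -
  let ?es = "\<lambda>\<delta> i. map (\<lambda>s. \<delta> * \<tau> ^ s) [0..<a - i + 1] @
              map (\<lambda>s. \<delta>\<^sub>1 * \<delta>\<^sub>2 * \<tau> ^ s) [a - i..<a + 1]"
  let ?fs = "map (\<lambda>s. \<delta>\<^sub>1 * \<tau> ^ s) [0..<a - m + 1]"
  let ?gs = "map (\<lambda>s. \<delta>\<^sub>2 * \<tau> ^ s) [0..<m + 1]"
  let ?I = "indices (a - m + 1) (a + b - m - n + 1)" and ?J = "indices (m + 1) (m + n + 1)"
  \<comment> \<open>Capital \<open>?S\<close> and \<open>?T\<close> add rationals, to which the
    rational identity applies; \<open>?s\<close> and \<open>?t\<close> add residues, as the finite
    sums in \<A> do.\<close>
  let ?S = "\<lambda>p \<delta> i j. \<Sum>ks\<in>indices (a - i + 1) (a + b - i - j + 1). \<Sum>ls\<in>indices (i + 1) (i + j + 1).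
      M_N p (ks @ ls) (?es \<delta> i)"
  let ?s = "\<lambda>p \<delta> i j. \<Sum>ks\<in>indices (a - i + 1) (a + b - i - j + 1). \<Sum>ls\<in>indices (i + 1) (i + j + 1).
      rat_mod (M_N p (ks @ ls) (?es \<delta> i)) (int p)"
  let ?T = "\<lambda>p \<delta> m n. \<Sum>i\<in>{0..a}. \<Sum>j\<in>{0..b}. of_nat ((i choose m) * (j choose n)) * ?S p \<delta> i j"
  let ?t = "\<lambda>p \<delta> m n. \<Sum>i\<in>{0..a}. \<Sum>j\<in>{0..b}. int ((i choose m) * (j choose n)) * ?s p \<delta> i j"
  \<comment> \<open>The last block of signs is in the form that reflection produces from
    \<open>?gs\<close>.\<close>
  have g: "map (\<lambda>s. - \<delta>\<^sub>2 * \<tau> ^ s) (rev [0..<m + 1]) = map uminus (rev ?gs)"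
    by (simp only: rev_map map_map comp_def mult_minus_left)
  let ?r = "\<lambda>p. \<Sum>ks\<in>?I. \<Sum>ls\<in>?J. (-1) ^ (m + n + 1) *
      rat_mod (M_N p (ks @ ls) (?fs @ map uminus (rev ?gs))) (int p)"
  have main: "[?t p \<delta>\<^sub>1 m n + ?t p \<delta>\<^sub>2 (a - m) (b - n) = ?r p] (mod int p)"
    if p: "prime p" "odd p" for p
  proof -
    have T: "?T p \<delta> m n \<in> plocal p" "[rat_mod (?T p \<delta> m n) (int p) = ?t p \<delta> m n] (mod int p)"
      for \<delta> m n
    proof -
      have M: "M_N p (ks @ ls) (?es \<delta> i) \<in> plocal p"
        if "i \<in> {0..a}" "ks \<in> indices (a - i + 1) N" "ls \<in> indices (i + 1) N'" for i ks ls N N'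
        using that by (intro plocal_M_N p(1)) (auto simp: indices_def)
      have S: "?S p \<delta> i j \<in> plocal p" if "i \<in> {0..a}" for i j
        by (intro plocal_sum M that)
      have c: "of_nat k \<in> plocal p" for k using plocal_of_int[of "int k" p] by simp
      show "?T p \<delta> m n \<in> plocal p"
        by (intro plocal_sum plocal_mult_rat_mod(1) c S)
      have s: "[rat_mod (?S p \<delta> i j) (int p) = ?s p \<delta> i j] (mod int p)" if "i \<in> {0..a}" for i j
        by (rule cong_trans[OF rat_mod_sum cong_sum[OF rat_mod_sum]]; intro plocal_sum M that)
      have "[rat_mod (of_nat k * ?S p \<delta> i j) (int p) = int k * ?s p \<delta> i j] (mod int p)"
        if "i \<in> {0..a}" for i j k
        using rat_mod_of_int[of "int k" p]
        by (intro cong_trans[OF plocal_mult_rat_mod(2)[OF c S[OF that]]] cong_mult s that) simp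
      then have "[(\<Sum>i\<in>{0..a}. \<Sum>j\<in>{0..b}. rat_mod (of_nat ((i choose m) * (j choose n)) * ?S p \<delta> i j) (int p)) =
          ?t p \<delta> m n] (mod int p)"
        by (intro cong_sum)
      moreover have "[rat_mod (?T p \<delta> m n) (int p) =
          (\<Sum>i\<in>{0..a}. \<Sum>j\<in>{0..b}. rat_mod (of_nat ((i choose m) * (j choose n)) * ?S p \<delta> i j) (int p))] (mod int p)"
        by (rule cong_trans[OF rat_mod_sum cong_sum[OF rat_mod_sum]];
            intro plocal_sum plocal_mult_rat_mod(1) c S)
      ultimately show "[rat_mod (?T p \<delta> m n) (int p) = ?t p \<delta> m n] (mod int p)"
        by (rule cong_trans[rotated])
    qed
    have C: "M_conv p ks ?fs ls ?gs \<in> plocal p" if "ks \<in> ?I" "ls \<in> ?J" for ks ls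
      using that by (intro plocal_M_conv p(1)) (auto simp: indices_def)
    have "[?t p \<delta>\<^sub>1 m n + ?t p \<delta>\<^sub>2 (a - m) (b - n) =
        rat_mod (?T p \<delta>\<^sub>1 m n) (int p) + rat_mod (?T p \<delta>\<^sub>2 (a - m) (b - n)) (int p)] (mod int p)"
      by (intro cong_add cong_sym[OF T(2)])
    also have "[rat_mod (?T p \<delta>\<^sub>1 m n) (int p) + rat_mod (?T p \<delta>\<^sub>2 (a - m) (b - n)) (int p) =
        rat_mod (?T p \<delta>\<^sub>1 m n + ?T p \<delta>\<^sub>2 (a - m) (b - n)) (int p)] (mod int p)"
      by (rule cong_sym[OF plocal_add_rat_mod(2)[OF T(1) T(1)]])
    also have "?T p \<delta>\<^sub>1 m n + ?T p \<delta>\<^sub>2 (a - m) (b - n) =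
        (\<Sum>ks\<in>?I. \<Sum>ls\<in>?J. M_conv p ks ?fs ls ?gs)"
      by (rule mixed_value_identity[OF assms(1-3) prime_gt_0_nat[OF p(1)] assms(5,7)])
    also have "[rat_mod (\<Sum>ks\<in>?I. \<Sum>ls\<in>?J. M_conv p ks ?fs ls ?gs) (int p) =
        (\<Sum>ks\<in>?I. \<Sum>ls\<in>?J. rat_mod (M_conv p ks ?fs ls ?gs) (int p))] (mod int p)"
      by (rule cong_trans[OF rat_mod_sum cong_sum[OF rat_mod_sum]]; intro plocal_sum C)
    also have "[(\<Sum>ks\<in>?I. \<Sum>ls\<in>?J. rat_mod (M_conv p ks ?fs ls ?gs) (int p)) =
        (\<Sum>ks\<in>?I. \<Sum>ls\<in>?J. (-1) ^ (m + n + 1) *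
          rat_mod (M_N p (ks @ rev ls) (?fs @ map uminus (rev ?gs))) (int p))] (mod int p)"
    proof (intro cong_sum)
      \<comment> \<open>Every \<open>ls\<close> here has weight m + n + 1, so reflection contributes
        the same sign throughout.\<close>
      fix ks ls assume "ks \<in> ?I" "ls \<in> ?J"
      then have "length ?fs = length ks" "length ?gs = length ls" "sum_list ls = m + n + 1"
        by (auto simp: indices_def)
      then show "[rat_mod (M_conv p ks ?fs ls ?gs) (int p) = (-1) ^ (m + n + 1) *
          rat_mod (M_N p (ks @ rev ls) (?fs @ map uminus (rev ?gs))) (int p)] (mod int p)"
        using rat_mod_M_conv[OF p] by metis
    qed
    \<comment> \<open>Reversal permutes the indices of given depth and weight, so
      \<open>rev ls\<close> can be renamed to \<open>ls\<close>.\<close>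
    also have "(\<Sum>ks\<in>?I. \<Sum>ls\<in>?J. (-1) ^ (m + n + 1) *
          rat_mod (M_N p (ks @ rev ls) (?fs @ map uminus (rev ?gs))) (int p)) = ?r p"
      by (intro sum.cong refl sum.reindex_bij_betw[OF indices_rev])
    finally show ?thesis .
  qed
  have "class_A (\<lambda>p. ?t p \<delta>\<^sub>1 m n + ?t p \<delta>\<^sub>2 (a - m) (b - n)) = class_A ?r"
    by (rule class_A_eqI[OF main])
  then show ?thesis
    unfolding M_A_def g
    by (simp only: class_A_finsum[OF finite_indices] class_A_finsum[OF finite_atLeastAtMost]
        class_A_nat_add_pow class_A_int_add_pow class_A_add)
qed

end
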